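(* Let $v$ be the fixed point with $z_1(v)=0$ in the $\gimel$-orbit of a $1$-singular point, let $\mathcal D_v$ be the universal ring of $v$, let $\mathcal B_v$ be the set of local distributions $D^1_\sigma,D^2_{\sigma'}$ defined in the context, and let $S$ be the complex vector space spanned by $\mathcal B_v$. Let $\mathfrak h$ be a Lie algebra and let $\Psi:\mathcal U(\mathfrak h)\to(\mathcal D_v,* )$ be a homomorphism of rings. Then $S$ is an $\mathfrak h$-module, where $X\in\mathfrak h$ acts on $D\in S$ by $X\cdot D=D\circ\Psi(X)$.
   Context: Tableaux and groups. Let $n\ge 2$ and let $V\simeq\mathbb C^{n(n+1)/2}$ be the complex manifold of tableaux $x=(x_{ki})_{1\le i\le k\le n}$ of complex numbers. Let $\gimel\simeq\mathbb Z^{n(n-1)/2}$ be the free abelian group generated by $\sigma_{st}$, $1\le t\le s\le n-1$, acting on $V$ by letting $\sigma_{st}$ add $1$ to the coordinate $x_{st}$ and fix all other coordinates. Let $G=S_1\times\cdots\times S_n$ (product of symmetric groups) act on $V$ by $(s(x))_{ki}=x_{k\,s_k(i)}$. Let $\mathcal M,\mathcal O$ be the sheaves of meromorphic and holomorphic functions on $V$. For a function $f$, $s\in G$, $\sigma\in\gimel$ put $\sigma(f)=f\circ\sigma^{-1}$, $s(f)=f\circ s^{-1}$, $s(\sigma)=s\circ\sigma\circ s^{-1}\in\gimel$. The ring $\mathcal R$. $\mathcal R$ is the set of finite formal sums $\sum_i f_i\sigma_i$ with $f_i$ meromorphic on $V$ and $\sigma_i\in\gimel$ (the free module over meromorphic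 functions with basis $\gimel$), with the skew group ring multiplication $(\sum_i f_i\sigma_i)\circ(\sum_j f'_j\sigma'_j)=\sum_{i,j}f_i\,\sigma_i(f'_j)\,\sigma_i\circ\sigma'_j$. A second multiplication is $A*B:=B\circ A$. $G$ acts on $\mathcal R$ by $s(\sum f_i\sigma_i)=\sum s(f_i)s(\sigma_i)$. The point $v$. A point $x^0\in V$ is $1$-singular if there are a row $k$ and indices $i\neq j$ such that $x^0_{ki}-x^0_{kj}\in\mathbb Z$ and $x^0_{rs}-x^0_{rt}\notin\mathbb Z$ for all $r$ and $s\ne t$ with $(r,\{s,t\})\neq(k,\{i,j\})$. Fix such $x^0$ and $k,i,j$. Put $z_1=x_{ki}-x_{kj}$, $z_2=x_{ki}+x_{kj}$, and let $z_3,z_4,\dots$ be the remaining coordinates $x_{st}$; $(z_1,z_2,\dots)$ are coordinates on $V$. Fix a point $v\in\gimel(x^0)$ with $z_1(v)=0$. Let $\tau\in G$ be the element with $\tau(z_1)=-z_1$, $\tau(z_l)=z_l$ for $l>1$ (the transposition of $i,j$ in row $k$). The stabilizer of $v$ in $G$ is $G_v=\{\mathrm{id},\tau\}$. Fix a sufficiently small open neighborhood $W$ of the orbit $\gimel(v)$, invariant under $\gimel$ and $\tau$; sufficiently small means in particular that the functions $x_{rs}-x_{rt}$, $s\ne t$, $(r,\{s,t\})\ne(k,\{i,j\})$, have no zeros in $W$. Elements of $\mathcal R$ are considered restricted to $W$. $\mathcal R^{G_v}$ denotes the $G_v$-invariants in $\mathcal R$, and $H^0(W,\mathcal O^{G_v})$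 the $\tau$-invariant holomorphic functions on $W$. The universal ring. $\mathcal D_v\subset\mathcal R^{G_v}$ is the subring generated by all elements of $\mathcal R^{G_v}$ of the form $\sum_i (H_i/z_1)\sigma_i$ (finite sum) with $H_i$ holomorphic in $W$. $\mathcal D_v$ acts on $H^0(W,\mathcal O^{G_v})$ by $(f\sigma)(F)=f\cdot(F\circ\sigma^{-1})$ extended additively. For a linear functional $D$ on $H^0(W,\mathcal O^{G_v})$ and $A\in\mathcal D_v$, $D\circ A$ is the functional $F\mapsto D(A(F))$; this makes functionals a left module over $(\mathcal D_v,* )$. $ev_v$ is evaluation at $v$. The distributions. For $\sigma,\sigma'\in\gimel$ with $\tau(\sigma')\neq\sigma'$ define functionals on $H^0(W,\mathcal O^{G_v})$: $D^1_\sigma=\frac12\,ev_v\circ(\sigma+\tau(\sigma))$, $D^2_{\sigma'}=ev_v\circ\frac{\sigma'-\tau(\sigma')}{2z_1}$. Let $\Delta$ be the set of $\sigma\in\gimel$ which act on the pair of coordinates $(x_{ki},x_{kj})$ by $(x_{ki},x_{kj})\mapsto(x_{ki}+m_1,x_{kj}+m_2)$ with $m_1\le m_2$. Put $\mathcal B_v=\{D^1_\sigma,D^2_{\sigma'}\mid\sigma,\sigma'\in\Delta,\ \tau(\sigma')\ne\sigma'\}$ and let $S\subset H^0(W,\mathcal O^{G_v})^*$ be its linear span.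
   Formalization: For a bare ring homomorphism Ψ, all module axioms except complex linearity in X are proved; that linearity (false for, e.g., conjugate-linear Ψ) is proved when Ψ is a homomorphism of complex algebras, i.e. sends scalars to scalars. *)

theory Defs
  imports
    "HOL-Analysis.Analysis"
    "HOL-Library.Function_Algebras"
    "HOL-Library.Poly_Mapping"
    "HOL-Algebra.QuotRing"
    "HOL-Algebra.Generated_Rings"
begin

section \<open>Tableaux, shifts and permutations\<close>

text \<open>The index set of the tableaux, with \<open>n = CARD('n)\<close>; the pair \<open>(k, i)\<close> is the position
  of \<open>x\<^sub>k\<^sub>i\<close>.\<close>

typedef ('n::finite) pos = "{(k, i). 1 \<le> i \<and> i \<le> k \<and> k \<le> CARD('n)} :: (nat \<times> nat) set"
proof -
  have "1 \<le> CARD('n)" by (simp add: Suc_leI)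
  then show ?thesis by (intro exI[of _ "(1, 1)"]) simp
qed

instance pos :: (finite) finite
proof
  have "range (Rep_pos :: 'a pos \<Rightarrow> _) \<subseteq> {..CARD('a)} \<times> {..CARD('a)}"
  proof (rule image_subsetI)
    fix r :: "'a pos"
    show "Rep_pos r \<in> {..CARD('a)} \<times> {..CARD('a)}" using Rep_pos[of r] by auto
  qed
  then have "finite (range (Rep_pos :: 'a pos \<Rightarrow> _))" by (rule finite_subset) simp
  then show "finite (UNIV :: 'a pos set)"
    by (rule finite_imageD) (simp add: inj_def Rep_pos_inject)
qed

type_synonym 'n tableau = "complex ^ 'n pos"

definition row :: "'n::finite pos \<Rightarrow> nat" where
  "row r = fst (Rep_pos r)"

text \<open>The group of shifts is written additively: \<open>m\<close> stands for the product of the powers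
  \<open>\<sigma>\<^sub>s\<^sub>t\<close> to the \<open>m (s, t)\<close>. In particular \<open>- m\<close> is the inverse shift.\<close>

definition shifts :: "('n::finite pos \<Rightarrow> int) set" where
  "shifts = {m. \<forall>r. row r = CARD('n) \<longrightarrow> m r = 0}"

definition shift :: "('n::finite pos \<Rightarrow> int) \<Rightarrow> 'n tableau \<Rightarrow> 'n tableau" where
  "shift m x = (\<chi> r. x $ r + of_int (m r))"

definition orbit :: "'n::finite tableau \<Rightarrow> 'n tableau set" where
  "orbit x = (\<lambda>m. shift m x) ` shifts"

text \<open>The product of the symmetric groups \<open>S\<^sub>1 \<times> \<dots> \<times> S\<^sub>n\<close>, as row preserving permutations.\<close>

definition row_perms :: "('n::finite pos \<Rightarrow> 'n pos) set" where
  "row_perms = {s. bij s \<and> (\<forall>r. row (s r) = row r)}"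

definition permute :: "('n::finite pos \<Rightarrow> 'n pos) \<Rightarrow> 'n tableau \<Rightarrow> 'n tableau" where
  "permute s x = (\<chi> r. x $ s r)"

definition stabilizer :: "'n::finite tableau \<Rightarrow> ('n pos \<Rightarrow> 'n pos) set" where
  "stabilizer x = {s \<in> row_perms. permute s x = x}"

text \<open>The action of permutations on shifts by conjugation, \<open>s(\<sigma>) = s \<circ> \<sigma> \<circ> s\<inverse>\<close>; see
  \<open>shift_perm_shift\<close>.\<close>

definition perm_shift :: "('n::finite pos \<Rightarrow> 'n pos) \<Rightarrow> ('n pos \<Rightarrow> int) \<Rightarrow> 'n pos \<Rightarrow> int" where
  "perm_shift s m = m \<circ> s"

lemma permute_inv:
  assumes "bij s"
  shows "permute s (permute (inv_into UNIV s) x) = x" "permute (inv_into UNIV s) (permute s x) = x"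
  using bij_is_inj[OF assms] bij_is_surj[OF assms]
  by (simp_all add: permute_def vec_eq_iff surj_f_inv_f)

lemma shift_perm_shift:
  assumes "bij s"
  shows "shift (perm_shift s m) = permute s \<circ> shift m \<circ> permute (inv_into UNIV s)"
  using bij_is_inj[OF assms]
  by (simp add: fun_eq_iff shift_def permute_def perm_shift_def vec_eq_iff)

lemma shift_add: "shift (m + m') = shift m \<circ> shift m'"
  by (simp add: fun_eq_iff shift_def vec_eq_iff)

section \<open>Holomorphic and meromorphic functions\<close>

definition hol_on :: "(complex ^ 'i \<Rightarrow> complex) \<Rightarrow> (complex ^ 'i) set \<Rightarrow> bool" where
  "hol_on f U \<longleftrightarrow>
     (\<forall>x\<in>U. \<exists>L. (f has_derivative L) (at x) \<and> (\<forall>c h. L (c *s h) = c * L h))"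

text \<open>Agreement on an open dense subset of \<open>N\<close>.\<close>

definition generically_eq ::
    "('a::topological_space) set \<Rightarrow> ('a \<Rightarrow> 'b) \<Rightarrow> ('a \<Rightarrow> 'b) \<Rightarrow> bool" where
  "generically_eq N f g \<longleftrightarrow> N \<subseteq> closure (interior {x \<in> N. f x = g x})"

definition regular_value ::
    "(complex ^ 'i) set \<Rightarrow> (complex ^ 'i \<Rightarrow> complex) \<Rightarrow> complex ^ 'i \<Rightarrow> complex \<Rightarrow> bool" where
  "regular_value U f x c \<longleftrightarrow>
     (\<exists>N F. open N \<and> x \<in> N \<and> N \<subseteq> U \<and> hol_on F N \<and> generically_eq N f F \<and> F x = c)"

lemma hol_on_imp_continuous_on: "hol_on f U \<Longrightarrow> continuous_on U f"
  unfolding hol_on_def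
  by (meson continuous_at_imp_continuous_on has_derivative_continuous)

lemma regular_value_unique:
  assumes "regular_value U f x c" "regular_value U f x d"
  shows "c = d"
proof (rule ccontr)
  assume ne: "c \<noteq> d"
  obtain N F where N: "open N" "x \<in> N" "hol_on F N" "generically_eq N f F" "F x = c"
    using assms(1) by (auto simp: regular_value_def)
  obtain M H where M: "open M" "x \<in> M" "hol_on H M" "generically_eq M f H" "H x = d"
    using assms(2) by (auto simp: regular_value_def)
  define V where "V = {y \<in> N \<inter> M. F y - H y \<noteq> 0}"
  have "continuous_on (N \<inter> M) (\<lambda>y. F y - H y)"
    using N(3) M(3) by (intro continuous_on_diff)
      (auto intro: continuous_on_subset hol_on_imp_continuous_on)
  then have "open ((\<lambda>y. F y - H y) -` (- {0}) \<inter> (N \<inter> M))"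
    using N(1) M(1) continuous_on_open_vimage[of "N \<inter> M"] by blast
  moreover have "(\<lambda>y. F y - H y) -` (- {0}) \<inter> (N \<inter> M) = V"
    by (auto simp: V_def)
  ultimately have V: "open V" by simp
  have xV: "x \<in> V" using N M ne by (simp add: V_def)
  let ?I = "interior {y \<in> N. f y = F y}" and ?J = "interior {y \<in> M. f y = H y}"
  have "V \<inter> ?I \<noteq> {}"
    using N(2,4) xV V open_Int_closure_eq_empty[of V ?I] unfolding generically_eq_def by blast
  then obtain y where y: "y \<in> V \<inter> ?I" by blast
  then have "y \<in> closure ?J"
    using M(4) unfolding generically_eq_def V_def by blast
  moreover have "open (V \<inter> ?I)" using V by blast
  ultimately have "V \<inter> ?I \<inter> ?J \<noteq> {}"
    using y open_Int_closure_eq_empty[of "V \<inter> ?I" ?J] by blast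
  then obtain w where w: "w \<in> V" "w \<in> ?I" "w \<in> ?J" by blast
  then have "f w = F w" "f w = H w" using interior_subset by blast+
  then show False using w(1) by (simp add: V_def)
qed

text \<open>The normal form of a meromorphic function on \<open>U\<close>: all removable singularities are removed,
  and the value is \<open>0\<close> at the remaining singularities and outside \<open>U\<close>. Two meromorphic functions on
  \<open>U\<close> are equal iff their normal forms are. This is the convention of \<open>nicely_meromorphic_on\<close> in
  one variable.\<close>

definition reg :: "(complex ^ 'i) set \<Rightarrow> (complex ^ 'i \<Rightarrow> complex) \<Rightarrow> complex ^ 'i \<Rightarrow> complex" where
  "reg U f x = (if \<exists>c. regular_value U f x c then THE c. regular_value U f x c else 0)"

text \<open>Locally a quotient of holomorphic functions whose denominator does not vanish identically
  on any nonempty open set.\<close>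

definition mero_on :: "(complex ^ 'i \<Rightarrow> complex) \<Rightarrow> (complex ^ 'i) set \<Rightarrow> bool" where
  "mero_on f U \<longleftrightarrow>
     (\<forall>x\<in>U. \<exists>N g h. open N \<and> x \<in> N \<and> N \<subseteq> U \<and> hol_on g N \<and> hol_on h N \<and>
        interior {y \<in> N. h y = 0} = {} \<and> (\<forall>y\<in>N. h y \<noteq> 0 \<longrightarrow> f y = g y / h y))"

definition mero :: "(complex ^ 'i) set \<Rightarrow> (complex ^ 'i \<Rightarrow> complex) set" where
  "mero U = {f. mero_on f U \<and> reg U f = f}"

section \<open>The skew group ring\<close>

text \<open>An element \<open>\<Sum> f\<^sub>i\<sigma>\<^sub>i\<close> is the finitely supported function that maps the shift \<open>\<sigma>\<^sub>i\<close> to its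
  coefficient \<open>f\<^sub>i\<close>, in normal form on \<open>W\<close>.\<close>

type_synonym 'n skew = "('n pos \<Rightarrow> int) \<Rightarrow> 'n tableau \<Rightarrow> complex"

definition supp :: "'n::finite skew \<Rightarrow> ('n pos \<Rightarrow> int) set" where
  "supp A = {m. A m \<noteq> 0}"

definition skew_const :: "'n::finite tableau set \<Rightarrow> complex \<Rightarrow> 'n skew" where
  "skew_const W c = (\<lambda>m x. if m = 0 \<and> x \<in> W then c else 0)"

text \<open>In the product, the coefficient of \<open>\<sigma>\<sigma>'\<close> collects the terms \<open>f (f' \<circ> \<sigma>\<inverse>)\<close>.\<close>

definition skew_ring :: "'n::finite tableau set \<Rightarrow> 'n skew ring" where
  "skew_ring W = \<lparr>
     carrier = {A. finite (supp A) \<and> supp A \<subseteq> shifts \<and> (\<forall>m. A m \<in> mero W)},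
     monoid.mult = (\<lambda>A B l. reg W (\<lambda>x. \<Sum>m\<in>supp A. A m x * B (l - m) (shift (- m) x))),
     one = skew_const W 1,
     zero = 0,
     add = (\<lambda>A B l. reg W (A l + B l))\<rparr>"

definition opposite :: "'a ring \<Rightarrow> 'a ring" where
  "opposite R = R\<lparr>monoid.mult := (\<lambda>a b. b \<otimes>\<^bsub>R\<^esub> a)\<rparr>"

definition perm_skew :: "('n::finite pos \<Rightarrow> 'n pos) \<Rightarrow> 'n skew \<Rightarrow> 'n skew" where
  "perm_skew s A = (\<lambda>l. A (perm_shift (inv_into UNIV s) l) \<circ> permute (inv_into UNIV s))"

definition skew_invariants :: "'n::finite tableau set \<Rightarrow> 'n tableau \<Rightarrow> 'n skew set" where
  "skew_invariants W v =
     {A \<in> carrier (skew_ring W). \<forall>s\<in>stabilizer v. perm_skew s A = A}"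

text \<open>Functions on \<open>W\<close> are extended by \<open>0\<close>, so that they are determined by their values on \<open>W\<close>.\<close>

definition hol_invariants ::
    "'n::finite tableau set \<Rightarrow> 'n tableau \<Rightarrow> ('n tableau \<Rightarrow> complex) set" where
  "hol_invariants W v =
     {F. hol_on F W \<and> (\<forall>x. x \<notin> W \<longrightarrow> F x = 0) \<and> (\<forall>s\<in>stabilizer v. F \<circ> permute (inv_into UNIV s) = F)}"

definition act :: "'n::finite tableau set \<Rightarrow> 'n skew \<Rightarrow> ('n tableau \<Rightarrow> complex) \<Rightarrow> 'n tableau \<Rightarrow> complex"
  where "act W A F = reg W (\<lambda>x. \<Sum>m\<in>supp A. A m x * F (shift (- m) x))"

section \<open>The universal ring of a singular point\<close>

text \<open>\<open>x\<close> is 1-singular, with the singular pair at the positions \<open>p\<close> and \<open>q\<close>.\<close>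

definition one_singular :: "'n::finite pos \<Rightarrow> 'n pos \<Rightarrow> 'n tableau \<Rightarrow> bool" where
  "one_singular p q x \<longleftrightarrow> row p = row q \<and> p \<noteq> q \<and> x $ p - x $ q \<in> \<int> \<and>
     (\<forall>r t. row r = row t \<and> r \<noteq> t \<and> {r, t} \<noteq> {p, q} \<longrightarrow> x $ r - x $ t \<notin> \<int>)"

definition z1 :: "'n::finite pos \<Rightarrow> 'n pos \<Rightarrow> 'n tableau \<Rightarrow> complex" where
  "z1 p q x = x $ p - x $ q"

abbreviation swap :: "'n::finite pos \<Rightarrow> 'n pos \<Rightarrow> 'n pos \<Rightarrow> 'n pos" where
  "swap p q \<equiv> Transposition.transpose p q"

lemma stabilizer_one_singular:
  assumes "one_singular p q x0" "v \<in> orbit x0" "z1 p q v = 0"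
  shows "stabilizer v = {id, swap p q}"
proof -
  obtain m where m: "v = shift m x0" using assms(2) by (auto simp: orbit_def)
  have pq: "row p = row q" "p \<noteq> q" "v $ p = v $ q"
    using assms by (auto simp: one_singular_def z1_def)
  have ne: "{r, t} = {p, q}" if "row r = row t" "r \<noteq> t" "v $ r = v $ t" for r t
  proof (rule ccontr)
    assume "{r, t} \<noteq> {p, q}"
    then have "x0 $ r - x0 $ t \<notin> \<int>" using assms(1) that by (auto simp: one_singular_def)
    moreover have "x0 $ r - x0 $ t = of_int (m t - m r)"
      using that(3) by (simp add: m shift_def algebra_simps)
    ultimately show False by (metis Ints_of_int)
  qed
  have "s = id \<or> s = swap p q" if "s \<in> stabilizer v" for s
  proof -
    have s: "bij s" "\<And>r. row (s r) = row r" "\<And>r. v $ s r = v $ r"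
      using that by (auto simp: stabilizer_def row_perms_def permute_def vec_eq_iff)
    have d: "s r = r \<or> {s r, r} = {p, q}" for r using ne s by blast
    have fx: "s r = r" if "r \<noteq> p" "r \<noteq> q" for r using d[of r] that by (auto simp: doubleton_eq_iff)
    have i: "s a = s b \<Longrightarrow> a = b" for a b using s(1) by (meson bij_is_inj injD)
    show ?thesis
    proof (cases "s p = p")
      case True
      then have "s q = q" using d[of q] i[of p q] pq(2) by (auto simp: doubleton_eq_iff)
      then have "s = id" using True fx by (metis eq_id_iff)
      then show ?thesis ..
    next
      case False
      then have "s p = q" "s q = p" using d[of p] d[of q] i[of p q] pq(2) by (auto simp: doubleton_eq_iff)
      then have "s = swap p q" using fx by (auto simp: fun_eq_iff Transposition.transpose_def)
      then show ?thesis ..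
    qed
  qed
  moreover have "id \<in> stabilizer v" "swap p q \<in> stabilizer v"
    using pq by (auto simp: stabilizer_def row_perms_def permute_def vec_eq_iff
        Transposition.transpose_def bij_id intro: bij_swap)
  ultimately show ?thesis by blast
qed

definition small_nbhd :: "'n::finite pos \<Rightarrow> 'n pos \<Rightarrow> 'n tableau \<Rightarrow> 'n tableau set \<Rightarrow> bool" where
  "small_nbhd p q v W \<longleftrightarrow> open W \<and> orbit v \<subseteq> W \<and>
     (\<forall>m\<in>shifts. shift m ` W = W) \<and> permute (swap p q) ` W = W \<and>
     (\<forall>r t. row r = row t \<and> r \<noteq> t \<and> {r, t} \<noteq> {p, q} \<longrightarrow> (\<forall>x\<in>W. x $ r - x $ t \<noteq> 0))"

definition universal_ring ::
    "'n::finite pos \<Rightarrow> 'n pos \<Rightarrow> 'n tableau \<Rightarrow> 'n tableau set \<Rightarrow> 'n skew ring" where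
  "universal_ring p q v W = (skew_ring W)\<lparr>carrier :=
     generate_ring (skew_ring W)
       {A \<in> skew_invariants W v.
          \<exists>H. \<forall>m. hol_on (H m) W \<and> A m = reg W (\<lambda>x. H m x / z1 p q x)}\<rparr>"

section \<open>Local distributions\<close>

text \<open>Functionals on \<open>hol_invariants W v\<close> are extended by \<open>0\<close>.\<close>

type_synonym 'n functional = "('n tableau \<Rightarrow> complex) \<Rightarrow> complex"

definition scale_functional :: "complex \<Rightarrow> 'n::finite functional \<Rightarrow> 'n functional" where
  "scale_functional c D = (\<lambda>F. c * D F)"

definition comp_act ::
    "'n::finite tableau set \<Rightarrow> 'n tableau \<Rightarrow> 'n functional \<Rightarrow> 'n skew \<Rightarrow> 'n functional" where
  "comp_act W v D A = (\<lambda>F. if F \<in> hol_invariants W v then D (act W A F) else 0)"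

definition monomial :: "('n::finite tableau \<Rightarrow> complex) \<Rightarrow> ('n pos \<Rightarrow> int) \<Rightarrow> 'n skew" where
  "monomial f m = (\<lambda>l. if l = m then f else 0)"

definition D1 :: "'n::finite pos \<Rightarrow> 'n pos \<Rightarrow> 'n tableau \<Rightarrow> 'n tableau set \<Rightarrow>
    ('n pos \<Rightarrow> int) \<Rightarrow> 'n functional" where
  "D1 p q v W m = scale_functional (1 / 2)
     (comp_act W v (\<lambda>F. F v) (monomial 1 m + monomial 1 (perm_shift (swap p q) m)))"

definition D2 :: "'n::finite pos \<Rightarrow> 'n pos \<Rightarrow> 'n tableau \<Rightarrow> 'n tableau set \<Rightarrow>
    ('n pos \<Rightarrow> int) \<Rightarrow> 'n functional" where
  "D2 p q v W m = comp_act W v (\<lambda>F. F v)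
     (monomial (\<lambda>x. 1 / (2 * z1 p q x)) m
      - monomial (\<lambda>x. 1 / (2 * z1 p q x)) (perm_shift (swap p q) m))"

definition half_shifts :: "'n::finite pos \<Rightarrow> 'n pos \<Rightarrow> ('n pos \<Rightarrow> int) set" where
  "half_shifts p q = {m \<in> shifts. m p \<le> m q}"

definition local_distributions ::
    "'n::finite pos \<Rightarrow> 'n pos \<Rightarrow> 'n tableau \<Rightarrow> 'n tableau set \<Rightarrow> 'n functional set" where
  "local_distributions p q v W =
     D1 p q v W ` half_shifts p q \<union>
     D2 p q v W ` {m \<in> half_shifts p q. perm_shift (swap p q) m \<noteq> m}"

definition distribution_space ::
    "'n::finite pos \<Rightarrow> 'n pos \<Rightarrow> 'n tableau \<Rightarrow> 'n tableau set \<Rightarrow> 'n functional set" where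
  "distribution_space p q v W = module.span scale_functional (local_distributions p q v W)"

section \<open>Lie algebras and enveloping algebras\<close>

locale lie_algebra = vector_space smul
  for smul :: "'k::field \<Rightarrow> 'h::ab_group_add \<Rightarrow> 'h" +
  fixes bracket :: "'h \<Rightarrow> 'h \<Rightarrow> 'h"
  assumes bracket_add_left: "bracket (x + y) z = bracket x z + bracket y z"
    and bracket_add_right: "bracket x (y + z) = bracket x y + bracket x z"
    and bracket_scale_left: "bracket (smul c x) y = smul c (bracket x y)"
    and bracket_scale_right: "bracket x (smul c y) = smul c (bracket x y)"
    and bracket_self: "bracket x x = 0"
    and jacobi: "bracket x (bracket y z) + bracket y (bracket z x) + bracket z (bracket x y) = 0"

text \<open>Words under concatenation, so that \<open>'h word \<Rightarrow>\<^sub>0 complex\<close> is the free associative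
  algebra on the set \<open>'h\<close>.\<close>

datatype 'h word = Word "'h list"

instantiation word :: (type) monoid_add
begin

definition zero_word :: "'a word" where
  "zero_word = Word []"

fun plus_word :: "'a word \<Rightarrow> 'a word \<Rightarrow> 'a word" where
  "plus_word (Word xs) (Word ys) = Word (xs @ ys)"

instance
proof
  fix a b c :: "'a word"
  show "a + b + c = a + (b + c)" by (cases a; cases b; cases c) simp
  show "0 + a = a" by (cases a) (simp add: zero_word_def)
  show "a + 0 = a" by (cases a) (simp add: zero_word_def)
qed

end

definition free_algebra :: "('h word \<Rightarrow>\<^sub>0 complex) ring" where
  "free_algebra = \<lparr>carrier = UNIV, monoid.mult = (*), one = 1, zero = 0, add = (+)\<rparr>"

definition gen :: "'h \<Rightarrow> 'h word \<Rightarrow>\<^sub>0 complex" where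
  "gen x = Poly_Mapping.single (Word [x]) 1"

text \<open>The first two families of relations turn the free algebra on the set \<open>'h\<close> into the tensor
  algebra of the vector space \<open>'h\<close>.\<close>

definition env_relations ::
    "(complex \<Rightarrow> 'h::ab_group_add \<Rightarrow> 'h) \<Rightarrow> ('h \<Rightarrow> 'h \<Rightarrow> 'h) \<Rightarrow> ('h word \<Rightarrow>\<^sub>0 complex) set" where
  "env_relations smul bracket =
     {gen (x + y) - (gen x + gen y) | x y. True} \<union>
     {gen (smul c x) - Poly_Mapping.single 0 c * gen x | c x. True} \<union>
     {gen x * gen y - gen y * gen x - gen (bracket x y) | x y. True}"

definition env_ideal ::
    "(complex \<Rightarrow> 'h::ab_group_add \<Rightarrow> 'h) \<Rightarrow> ('h \<Rightarrow> 'h \<Rightarrow> 'h) \<Rightarrow> ('h word \<Rightarrow>\<^sub>0 complex) set" where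
  "env_ideal smul bracket = Idl\<^bsub>free_algebra\<^esub> (env_relations smul bracket)"

definition env_algebra ::
    "(complex \<Rightarrow> 'h::ab_group_add \<Rightarrow> 'h) \<Rightarrow> ('h \<Rightarrow> 'h \<Rightarrow> 'h) \<Rightarrow> ('h word \<Rightarrow>\<^sub>0 complex) set ring" where
  "env_algebra smul bracket = free_algebra Quot (env_ideal smul bracket)"

definition env_incl :: "(complex \<Rightarrow> 'h::ab_group_add \<Rightarrow> 'h) \<Rightarrow> ('h \<Rightarrow> 'h \<Rightarrow> 'h) \<Rightarrow>
    'h \<Rightarrow> ('h word \<Rightarrow>\<^sub>0 complex) set" where
  "env_incl smul bracket x = env_ideal smul bracket +>\<^bsub>free_algebra\<^esub> gen x"

definition env_const :: "(complex \<Rightarrow> 'h::ab_group_add \<Rightarrow> 'h) \<Rightarrow> ('h \<Rightarrow> 'h \<Rightarrow> 'h) \<Rightarrow>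
    complex \<Rightarrow> ('h word \<Rightarrow>\<^sub>0 complex) set" where
  "env_const smul bracket c = env_ideal smul bracket +>\<^bsub>free_algebra\<^esub> Poly_Mapping.single 0 c"

text \<open>A subspace \<open>S\<close> on which the Lie algebra, regarded as a Lie ring, acts by linear maps
  \<open>rho x\<close>. Linearity in the scalars of the Lie algebra is added in \<open>lie_module\<close>.\<close>

definition lie_ring_module :: "('h::ab_group_add \<Rightarrow> 'h \<Rightarrow> 'h) \<Rightarrow>
    ('k::field \<Rightarrow> 'm::ab_group_add \<Rightarrow> 'm) \<Rightarrow> 'm set \<Rightarrow> ('h \<Rightarrow> 'm \<Rightarrow> 'm) \<Rightarrow> bool" where
  "lie_ring_module bracket mscale S rho \<longleftrightarrow>
     vector_space mscale \<and> module.subspace mscale S \<and>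
     (\<forall>x. \<forall>D\<in>S. rho x D \<in> S) \<and>
     (\<forall>x. \<forall>D\<in>S. \<forall>E\<in>S. rho x (D + E) = rho x D + rho x E) \<and>
     (\<forall>x c. \<forall>D\<in>S. rho x (mscale c D) = mscale c (rho x D)) \<and>
     (\<forall>x y. \<forall>D\<in>S. rho (x + y) D = rho x D + rho y D) \<and>
     (\<forall>x y. \<forall>D\<in>S. rho (bracket x y) D = rho x (rho y D) - rho y (rho x D))"

definition lie_module :: "('k::field \<Rightarrow> 'h::ab_group_add \<Rightarrow> 'h) \<Rightarrow> ('h \<Rightarrow> 'h \<Rightarrow> 'h) \<Rightarrow>
    ('k \<Rightarrow> 'm::ab_group_add \<Rightarrow> 'm) \<Rightarrow> 'm set \<Rightarrow> ('h \<Rightarrow> 'm \<Rightarrow> 'm) \<Rightarrow> bool" where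
  "lie_module smul bracket mscale S rho \<longleftrightarrow>
     lie_ring_module bracket mscale S rho \<and>
     (\<forall>c x. \<forall>D\<in>S. rho (smul c x) D = mscale c (rho x D))"

end

theory Submission
  imports Defs "HOL-Complex_Analysis.Conformal_Mappings"
begin

text \<open>Write \<open>\<tau>\<close> for the transposition of the singular pair and \<open>z\<close> for the coordinate \<open>z\<^sub>1\<close>.

  A generator \<open>\<Sum> (H\<^sub>m / z) m\<close> of the universal ring is \<open>\<tau>\<close>-invariant. Hence, for a
  \<open>\<tau>\<close>-invariant \<open>F\<close>, the sum \<open>S = \<Sum> H\<^sub>m (F \<circ> m\<inverse>)\<close> changes sign under \<open>\<tau>\<close>, so it vanishes on the
  hyperplane \<open>z = 0\<close>, which \<open>\<tau>\<close> fixes pointwise. It is therefore divisible by \<open>z\<close>, the quotient is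
  again holomorphic and invariant, and its values on the hyperplane are the derivatives of \<open>S\<close>
  transversal to it (\<open>hyperplane_division\<close>, \<open>generator_act\<close>). So the universal ring acts on invariant
  holomorphic functions, and functionals become a left module over the opposite ring; restricting
  along a ring homomorphism from the enveloping algebra gives a module over the Lie algebra. The
  substance is that the span of the local distributions is preserved.

  The two kinds of local distributions are the evaluations of \<open>F\<close> and of its transversal derivative at
  the points of the orbit of \<open>v\<close> (\<open>D1_eq_evaluation\<close>, \<open>D2_eq_derivative\<close>). Points interchanged by \<open>\<tau>\<close>
  give the same functionals up to sign, so half of the shifts suffice for the span. Let \<open>w\<close> be such a
  point and \<open>A\<close> a generator. If \<open>z w \<noteq> 0\<close>, then near \<open>w\<close> the function \<open>A F\<close> is a combination of shifts
  of \<open>F\<close> with holomorphic coefficients, and by the Leibniz rule its value and its derivative at \<open>w\<close>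
  are combinations of values and derivatives of \<open>F\<close> at points of the orbit. If \<open>z w = 0\<close>, then the
  value of \<open>A F\<close> at \<open>w\<close> is the derivative of \<open>S\<close>, to which the Leibniz rule applies again, and the
  derivative of \<open>A F\<close> at \<open>w\<close> is zero because \<open>A F\<close> is even with respect to \<open>\<tau>\<close>
  (\<open>generator_stable\<close>). Stability passes from the generators to the generated ring because the
  action is compatible with the ring operations (\<open>act_add\<close>, \<open>act_mult\<close>).

  Holomorphy of several variables means complex Frechet differentiability at every point. The
  division by \<open>z\<close> rests on a Riemann extension theorem across a hyperplane
  (\<open>riemann_extension_hyperplane\<close>), which is reduced to one variable by restriction to complex lines.
  Identities between elements of the skew group ring are checked on the open dense set where \<open>z\<close>
  is not an integer: all coefficients that occur are holomorphic there, and the set is stable under all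
  shifts.\<close>

section \<open>Holomorphic functions of several variables\<close>

lemma hol_onD:
  assumes "hol_on f U" "x \<in> U"
  shows "(f has_derivative frechet_derivative f (at x)) (at x)"
    and "frechet_derivative f (at x) (c *s h) = c * frechet_derivative f (at x) h"
proof -
  obtain L where L: "(f has_derivative L) (at x)" "\<And>c h. L (c *s h) = c * L h"
    using assms unfolding hol_on_def by blast
  have "L = frechet_derivative f (at x)" using L(1) by (rule frechet_derivative_at)
  then show "(f has_derivative frechet_derivative f (at x)) (at x)"
    "frechet_derivative f (at x) (c *s h) = c * frechet_derivative f (at x) h"
    using L by simp_all
qed

lemma hol_onI:
  assumes "\<And>x. x \<in> U \<Longrightarrow> (f has_derivative L x) (at x)"
    and "\<And>x c h. x \<in> U \<Longrightarrow> L x (c *s h) = c * L x h"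
  shows "hol_on f U"
  unfolding hol_on_def using assms by blast

lemma hol_on_subset: "hol_on f U \<Longrightarrow> V \<subseteq> U \<Longrightarrow> hol_on f V"
  unfolding hol_on_def by blast

lemma hol_on_const [simp]: "hol_on (\<lambda>x. c) U"
  by (rule hol_onI[where L = "\<lambda>x h. 0"]) (auto intro!: derivative_eq_intros)

lemma hol_on_add: "hol_on f U \<Longrightarrow> hol_on g U \<Longrightarrow> hol_on (\<lambda>x. f x + g x) U"
  by (rule hol_onI, rule has_derivative_add) (auto intro: hol_onD simp: hol_onD(2) algebra_simps)

lemma hol_on_mult: "hol_on f U \<Longrightarrow> hol_on g U \<Longrightarrow> hol_on (\<lambda>x. f x * g x) U"
  by (rule hol_onI, rule has_derivative_mult) (auto intro: hol_onD simp: hol_onD(2) algebra_simps)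

lemma hol_on_minus: "hol_on f U \<Longrightarrow> hol_on (\<lambda>x. - f x) U"
  using hol_on_mult[of "\<lambda>x. -1" U f] by simp

lemma hol_on_sum: "(\<And>i. i \<in> I \<Longrightarrow> hol_on (f i) U) \<Longrightarrow> hol_on (\<lambda>x. \<Sum>i\<in>I. f i x) U"
  by (induction I rule: infinite_finite_induct) (auto intro!: hol_on_add)

lemma hol_on_divide:
  assumes "hol_on f U" "hol_on g U" "\<And>x. x \<in> U \<Longrightarrow> g x \<noteq> 0"
  shows "hol_on (\<lambda>x. f x / g x) U"
  by (rule hol_onI, rule has_derivative_divide')
    (auto intro: hol_onD assms simp: hol_onD(2)[OF assms(1)] hol_onD(2)[OF assms(2)] assms(3) field_simps)

lemma hol_on_cong_open:
  assumes "open U" "\<And>x. x \<in> U \<Longrightarrow> f x = g x" "hol_on f U"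
  shows "hol_on g U"
proof (rule hol_onI)
  fix x assume x: "x \<in> U"
  show "(g has_derivative frechet_derivative f (at x)) (at x)"
    using has_derivative_transform_within_open[OF hol_onD(1)[OF assms(3) x] assms(1) x] assms(2) by auto
qed (simp add: hol_onD(2)[OF assms(3)])

lemma hol_on_local:
  assumes "\<And>x. x \<in> U \<Longrightarrow> \<exists>V. x \<in> V \<and> hol_on f V"
  shows "hol_on f U"
  using assms unfolding hol_on_def by meson

lemma hol_on_compose_affine:
  fixes T :: "complex ^ 'i \<Rightarrow> complex ^ 'j"
  assumes f: "hol_on f U" and T: "\<And>x. x \<in> V \<Longrightarrow> T x \<in> U"
    and d: "\<And>x. x \<in> V \<Longrightarrow> (T has_derivative M) (at x)" and M: "\<And>c h. M (c *s h) = c *s M h"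
  shows "hol_on (\<lambda>x. f (T x)) V"
    and "x \<in> V \<Longrightarrow> ((\<lambda>x. f (T x)) has_derivative (\<lambda>h. frechet_derivative f (at (T x)) (M h))) (at x)"
proof -
  show *: "((\<lambda>x. f (T x)) has_derivative (\<lambda>h. frechet_derivative f (at (T x)) (M h))) (at x)" if "x \<in> V" for x
    using diff_chain_at[OF d[OF that] hol_onD(1)[OF f T[OF that]]] by (simp add: o_def)
  show "hol_on (\<lambda>x. f (T x)) V"
    by (rule hol_onI[OF *]) (auto simp: M hol_onD(2)[OF f T])
qed

lemma complex_linear_expansion:
  fixes L :: "complex ^ 'i \<Rightarrow> complex"
  assumes "linear L" "\<And>c h. L (c *s h) = c * L h"
  shows "L h = (\<Sum>i\<in>UNIV. L (axis i 1) * h $ i)"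
proof -
  have "L h = L (\<Sum>i\<in>UNIV. (h $ i) *s axis i 1)" by (simp add: basis_expansion)
  also have "\<dots> = (\<Sum>i\<in>UNIV. L ((h $ i) *s axis i 1))" by (rule linear_sum[OF assms(1)])
  finally show ?thesis by (simp add: assms(2) mult.commute)
qed

lemma norm_vector_smult: "norm (c *s (h :: complex ^ 'i)) = cmod c * norm h"
  by (simp add: norm_vec_def norm_mult L2_set_right_distrib)

lemma has_derivative_line:
  "((\<lambda>s. x + s *s h) has_derivative (\<lambda>t. t *s (h :: complex ^ 'i))) (at s)"
proof -
  have "linear (\<lambda>t. t *s (h :: complex ^ 'i))"
    by (rule linearI) (auto simp: vec_eq_iff algebra_simps)
  then have "bounded_linear (\<lambda>t. t *s (h :: complex ^ 'i))"
    by (simp add: linear_conv_bounded_linear)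
  then show ?thesis by (auto intro!: derivative_eq_intros bounded_linear_imp_has_derivative)
qed

lemma hol_on_line:
  assumes "hol_on f U" "x + s *s h \<in> U"
  shows "((\<lambda>s. f (x + s *s h)) has_field_derivative frechet_derivative f (at (x + s *s h)) h) (at s)"
proof -
  have "((\<lambda>s. f (x + s *s h)) has_derivative (\<lambda>t. frechet_derivative f (at (x + s *s h)) (t *s h))) (at s)"
    using diff_chain_at[OF has_derivative_line hol_onD(1)[OF assms]] by (simp add: o_def)
  then show ?thesis
    by (simp add: has_field_derivative_def hol_onD(2)[OF assms] mult.commute[of _ "frechet_derivative f (at (x + s *s h)) h"])
qed

lemma hol_on_line_holomorphic:
  assumes "hol_on f U" "\<And>s. s \<in> T \<Longrightarrow> x + s *s h \<in> U"
  shows "(\<lambda>s. f (x + s *s h)) holomorphic_on T"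
  unfolding holomorphic_on_def field_differentiable_def
  using hol_on_line[OF assms(1) assms(2)] has_field_derivative_at_within by blast

section \<open>Cauchy estimates in one variable\<close>

text \<open>On a circle of radius \<open>r < \<rho>\<close> the quotient is at most \<open>2 * M / r\<close>. The maximum principle carries the
  bound to the disc inside, and \<open>r\<close> may tend to \<open>\<rho>\<close>.\<close>

lemma difference_quotient_bound:
  fixes g :: "complex \<Rightarrow> complex"
  assumes hol: "g holomorphic_on ball 0 \<rho>" and M: "\<And>s. s \<in> ball 0 \<rho> \<Longrightarrow> cmod (g s) \<le> M" and \<rho>: "\<rho> > 0"
  defines "Q \<equiv> \<lambda>s. if s = 0 then deriv g 0 else (g s - g 0) / s"
  shows "Q holomorphic_on ball 0 \<rho>" and "s \<in> ball 0 \<rho> \<Longrightarrow> cmod (Q s) \<le> 2 * M / \<rho>"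
proof -
  show Q: "Q holomorphic_on ball 0 \<rho>"
    using pole_lemma[OF hol, of 0] \<rho> unfolding Q_def by (simp cong: if_cong)
  assume s: "s \<in> ball 0 \<rho>"
  have M0: "M \<ge> 0" using M[of 0] \<rho> norm_ge_zero[of "g 0"] by (metis centre_in_ball order_trans)
  have b: "cmod (Q s) \<le> 2 * M / r" if r: "cmod s < r" "r < \<rho>" for r
  proof (rule maximum_modulus_frontier[of Q "ball 0 r"])
    have r0: "r > 0" using r(1) norm_ge_zero[of s] by linarith
    show "Q holomorphic_on interior (ball 0 r)"
      using Q r by (auto intro: holomorphic_on_subset)
    show "continuous_on (closure (ball 0 r)) Q"
      using r r0 by (intro holomorphic_on_imp_continuous_on holomorphic_on_subset[OF Q]) auto
    fix z :: complex assume "z \<in> frontier (ball 0 r)"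
    then have z: "cmod z = r" using r0 by (simp add: frontier_def dist_norm)
    have "cmod (g z - g 0) \<le> 2 * M"
      using M[of z] M[of 0] z r \<rho> norm_triangle_ineq4[of "g z" "g 0"] by simp
    then show "cmod (Q z) \<le> 2 * M / r"
      using z r0 by (auto simp: Q_def norm_divide divide_right_mono)
  qed (use r in auto)
  have "((\<lambda>r. 2 * M / r) \<longlongrightarrow> 2 * M / \<rho>) (at_left \<rho>)"
    using \<rho> by (intro tendsto_intros) auto
  moreover have "eventually (\<lambda>r. cmod (Q s) \<le> 2 * M / r) (at_left \<rho>)"
    using s by (auto simp: eventually_at_left intro!: exI[of _ "cmod s"] b)
  ultimately show "cmod (Q s) \<le> 2 * M / \<rho>"
    by (rule tendsto_lowerbound) simp
qed

text \<open>A bounded function extends across \<open>a\<close>, and the remainder of first order is the difference quotient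
  of its difference quotient. In the application the disc lies in a complex line, which meets the hyperplane at
  the parameter \<open>a\<close>; the parameters \<open>0\<close> and \<open>1\<close> are the two points that are compared.\<close>

lemma bounded_punctured_taylor:
  fixes g :: "complex \<Rightarrow> complex"
  assumes hol: "g holomorphic_on ball 0 \<rho> - {a}" and M: "\<And>s. s \<in> ball 0 \<rho> - {a} \<Longrightarrow> cmod (g s) \<le> M"
    and \<rho>: "\<rho> > 0" and a: "a \<noteq> 0"
  shows "cmod (deriv g 0) \<le> 2 * M / \<rho>"
    and "\<rho> > 1 \<Longrightarrow> a \<noteq> 1 \<Longrightarrow> cmod (g 1 - g 0 - deriv g 0) \<le> 4 * M / \<rho>\<^sup>2"
proof -
  obtain f where f: "f holomorphic_on ball 0 \<rho>" "\<And>s. s \<in> ball 0 \<rho> - {a} \<Longrightarrow> f s = g s"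
  proof (cases "a \<in> ball 0 \<rho>")
    case True
    have "eventually (\<lambda>z. z \<in> ball 0 \<rho> - {a}) (at a)"
      using True by (auto simp: eventually_at_filter intro: eventually_nhds_in_open eventually_mono[OF eventually_nhds_in_open[of "ball 0 \<rho>"]])
    then have "\<exists>B. eventually (\<lambda>z. norm (g z) \<le> B) (at a)"
      by (intro exI[of _ M]) (rule eventually_mono, assumption, rule M)
    then show ?thesis using holomorphic_on_extend_bounded[OF hol] True that by auto
  next
    case False
    then show ?thesis using hol that[of g] by simp
  qed
  have fM: "cmod (f s) \<le> M" if s: "s \<in> ball 0 \<rho>" for s
  proof (cases "s = a")
    case True
    have "isCont f a" using f(1) s True
      by (metis centre_in_ball continuous_on_interior holomorphic_on_imp_continuous_on interior_open open_ball)
    then have "((\<lambda>z. cmod (f z)) \<longlongrightarrow> cmod (f a)) (at a)"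
      by (intro tendsto_norm) (simp add: isCont_def)
    moreover have "eventually (\<lambda>z. z \<in> ball 0 \<rho> - {a}) (at a)"
      using s True by (auto simp: eventually_at_filter intro: eventually_mono[OF eventually_nhds_in_open[of "ball 0 \<rho>"]])
    then have "eventually (\<lambda>z. cmod (f z) \<le> M) (at a)"
      by (rule eventually_mono) (use M f(2) in auto)
    ultimately show ?thesis using True by (auto intro: tendsto_upperbound)
  next
    case False then show ?thesis using s M f(2)[of s] by simp
  qed
  have d: "deriv g 0 = deriv f 0"
  proof (rule deriv_cong_ev)
    have "eventually (\<lambda>z. z \<in> ball 0 \<rho> - {a}) (nhds 0)"
      using \<rho> a by (intro eventually_nhds_in_open) auto
    then show "eventually (\<lambda>z. g z = f z) (nhds 0)" by (rule eventually_mono) (use f(2) in auto)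
  qed simp
  define Q where "Q = (\<lambda>s. if s = 0 then deriv f 0 else (f s - f 0) / s)"
  have Q: "Q holomorphic_on ball 0 \<rho>" "\<And>s. s \<in> ball 0 \<rho> \<Longrightarrow> cmod (Q s) \<le> 2 * M / \<rho>"
    using difference_quotient_bound[OF f(1) fM \<rho>] unfolding Q_def by auto
  show "cmod (deriv g 0) \<le> 2 * M / \<rho>" using Q(2)[of 0] \<rho> by (simp add: d Q_def)
  assume r1: "\<rho> > 1" and a1: "a \<noteq> 1"
  have "cmod ((Q 1 - Q 0) / 1) \<le> 2 * (2 * M / \<rho>) / \<rho>"
    using difference_quotient_bound(2)[OF Q \<rho>, of 1] r1 by simp
  moreover have "Q 1 - Q 0 = g 1 - g 0 - deriv g 0"
    using f(2)[of 1] f(2)[of 0] a a1 r1 by (simp add: Q_def d)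
  ultimately show "cmod (g 1 - g 0 - deriv g 0) \<le> 4 * M / \<rho>\<^sup>2" by (simp add: power2_eq_square)
qed

section \<open>Riemann extension across a hyperplane\<close>

text \<open>A move by \<open>t *s e\<close> changes \<open>l\<close> by \<open>t * l e\<close>, so it is enough to avoid \<open>C\<close> by small changes of the
  value.\<close>

lemma dense_off_hyperplane:
  fixes l :: "complex ^ 'i \<Rightarrow> complex"
  assumes lin: "linear l" and sc: "\<And>c h. l (c *s h) = c * l h" and e: "l e \<noteq> 0"
    and C: "\<And>r. r > 0 \<Longrightarrow> \<exists>t. cmod t < r \<and> l x + t * l e \<notin> C"
  shows "x \<in> closure {y. l y \<notin> C}"
  unfolding closure_approachable
proof (intro allI impI)
  fix \<epsilon> :: real assume \<epsilon>: "\<epsilon> > 0"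
  have e0: "norm e > 0" using e linear_0[OF lin] by auto
  obtain t where t: "cmod t < \<epsilon> / norm e" "l x + t * l e \<notin> C"
    using C[of "\<epsilon> / norm e"] \<epsilon> e0 by auto
  have "l (x + t *s e) = l x + t * l e" by (simp add: linear_add[OF lin] sc)
  moreover have "dist (x + t *s e) x < \<epsilon>"
    using t e0 by (simp add: dist_norm norm_vector_smult field_simps)
  ultimately show "\<exists>y\<in>{y. l y \<notin> C}. dist y x < \<epsilon>"
    using t(2) by (intro bexI[of _ "x + t *s e"]) auto
qed

lemma dense_nonzero:
  fixes l :: "complex ^ 'i \<Rightarrow> complex"
  assumes lin: "linear l" and sc: "\<And>c h. l (c *s h) = c * l h" and e: "l e \<noteq> 0"
  shows "x \<in> closure {y. l y \<noteq> 0}"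
proof (cases "l x = 0")
  case True
  have *: "\<exists>t. cmod t < r \<and> l x + t * l e \<notin> {0}" if "r > 0" for r
    using that e True by (intro exI[of _ "of_real (r / 2)"]) auto
  show ?thesis using dense_off_hyperplane[OF lin sc e *] by simp
next
  case False then show ?thesis using subsetD[OF closure_subset, of x "{y. l y \<noteq> 0}"] by simp
qed

text \<open>The complex line through \<open>x\<close> and \<open>y\<close> meets the hyperplane in at most one point, or in none if it is
  parallel, so the estimates in one variable apply on it. Their constants depend on \<open>R\<close> and \<open>M\<close>
  alone and not on the distance of \<open>x\<close> from the hyperplane; this allows \<open>x\<close> to tend to a point
  of the hyperplane afterwards.\<close>

lemma taylor_off_hyperplane:
  fixes l :: "complex ^ 'i \<Rightarrow> complex"
  assumes lin: "linear l" and sc: "\<And>c h. l (c *s h) = c * l h"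
    and hol: "hol_on G (ball w R - {x. l x = 0})"
    and M: "\<And>x. x \<in> ball w R \<Longrightarrow> l x \<noteq> 0 \<Longrightarrow> cmod (G x) \<le> M"
    and R: "R > 0" and x: "x \<in> ball w (R / 4)" "l x \<noteq> 0"
  shows "cmod (frechet_derivative G (at x) h) \<le> 8 * M / (3 * R) * norm h"
    and "y \<in> ball w (R / 4) \<Longrightarrow> l y \<noteq> 0 \<Longrightarrow>
      cmod (G y - G x - frechet_derivative G (at x) (y - x)) \<le> 64 * M / (9 * R\<^sup>2) * (norm (y - x))\<^sup>2"
proof -
  have xR: "x \<in> ball w R - {x. l x = 0}" using x R by auto
  \<comment> \<open>The parameters for which the line stays within \<open>3 * R / 4\<close> of \<open>x\<close>, and hence in the large ball.\<close>
  define \<rho> where "\<rho> h = 3 * R / (4 * norm h)" for h :: "complex ^ 'i"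
  \<comment> \<open>The line meets the hyperplane at \<open>a h\<close>. For a parallel line any value other than \<open>0\<close> and \<open>1\<close> will do.\<close>
  define a where "a h = (if l h = 0 then 2 else - l x / l h)" for h
  define g where "g h = (\<lambda>s. G (x + s *s h))" for h
  have \<rho>: "\<rho> h > 0" if "h \<noteq> 0" for h using R that by (simp add: \<rho>_def)
  have a0: "a h \<noteq> 0" for h using x by (simp add: a_def)
  have ln: "x + s *s h \<in> ball w R - {x. l x = 0}" if "h \<noteq> 0" "s \<in> ball 0 (\<rho> h) - {a h}" for h s
  proof -
    have "cmod s * norm h < 3 * R / 4"
      using that by (simp add: \<rho>_def field_simps)
    moreover have "dist w (x + s *s h) \<le> dist w x + cmod s * norm h"
      using dist_triangle[of w "x + s *s h" x] by (simp add: dist_norm norm_vector_smult)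
    ultimately have "dist w (x + s *s h) < R" using x(1) by simp
    moreover have "l x + s * l h \<noteq> 0"
      using that(2) x(2) by (auto simp: a_def field_simps add_eq_0_iff split: if_splits)
    ultimately show ?thesis by (simp add: linear_add[OF lin] sc)
  qed
  have g: "g h holomorphic_on ball 0 (\<rho> h) - {a h}" if "h \<noteq> 0" for h
    unfolding g_def by (rule hol_on_line_holomorphic[OF hol ln[OF that]])
  have gM: "cmod (g h s) \<le> M" if "h \<noteq> 0" "s \<in> ball 0 (\<rho> h) - {a h}" for h s
    using ln[OF that] M by (simp add: g_def)
  have d: "deriv (g h) 0 = frechet_derivative G (at x) h" for h
    using hol_on_line[OF hol, of x 0 h] xR by (simp add: g_def DERIV_imp_deriv)
  show "cmod (frechet_derivative G (at x) h) \<le> 8 * M / (3 * R) * norm h"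
  proof (cases "h = 0")
    case True
    have "linear (frechet_derivative G (at x))"
      using hol_onD(1)[OF hol xR] has_derivative_linear by blast
    then show ?thesis using True by (simp add: linear_0)
  next
    case False
    then show ?thesis
      using bounded_punctured_taylor(1)[OF g[OF False] gM[OF False] \<rho>[OF False] a0] by (simp add: d \<rho>_def field_simps)
  qed
  assume y: "y \<in> ball w (R / 4)" "l y \<noteq> 0"
  show "cmod (G y - G x - frechet_derivative G (at x) (y - x)) \<le> 64 * M / (9 * R\<^sup>2) * (norm (y - x))\<^sup>2"
  proof (cases "y = x")
    case True
    have "linear (frechet_derivative G (at x))"
      using hol_onD(1)[OF hol xR] has_derivative_linear by blast
    then show ?thesis using True by (simp add: linear_0)
  next
    case False
    define h where "h = y - x"
    have h: "h \<noteq> 0" using False by (simp add: h_def)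
    have "dist x y < R / 2" using dist_triangle[of x y w] x(1) y(1) by (simp add: dist_commute)
    then have "norm h < R / 2" by (simp add: h_def dist_norm norm_minus_commute)
    then have r1: "\<rho> h > 1" using h R by (simp add: \<rho>_def field_simps)
    have "a h \<noteq> 1"
    proof
      assume "a h = 1"
      then have "l h \<noteq> 0" "- l x = l h" by (auto simp: a_def field_simps split: if_splits)
      then have "l x + l h = 0" by (metis add.right_inverse)
      then show False using y(2) linear_add[OF lin, of x h] by (simp add: h_def)
    qed
    moreover have "g h 1 = G y" "g h 0 = G x" by (simp_all add: g_def h_def)
    ultimately have "cmod (G y - G x - frechet_derivative G (at x) h) \<le> 4 * M / (\<rho> h)\<^sup>2"
      using bounded_punctured_taylor(2)[OF g[OF h] gM[OF h] \<rho>[OF h] a0 r1] by (simp add: d)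
    also have "\<dots> = 64 * M / (9 * R\<^sup>2) * (norm h)\<^sup>2"
      using h R by (simp add: \<rho>_def field_simps power2_eq_square)
    finally show ?thesis by (simp add: h_def)
  qed
qed

text \<open>Along a sequence \<open>x n\<close> that tends to \<open>w\<close> off the hyperplane, the values of \<open>G\<close> and its gradients are
  bounded. Limits along a common subsequence give \<open>c\<close> and \<open>L\<close>, and the uniform Taylor estimate at
  \<open>x n\<close> turns into one at \<open>w\<close>.\<close>

lemma limit_expansion_on_hyperplane:
  fixes l :: "complex ^ 'i \<Rightarrow> complex"
  assumes lin: "linear l" and sc: "\<And>c h. l (c *s h) = c * l h" and e: "l e \<noteq> 0"
    and hol: "hol_on G (ball w R - {x. l x = 0})"
    and M: "\<And>x. x \<in> ball w R \<Longrightarrow> l x \<noteq> 0 \<Longrightarrow> cmod (G x) \<le> M"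
    and R: "R > 0" and w: "l w = 0"
  obtains c L K where "bounded_linear L" "\<And>c h. L (c *s h) = c * L h"
    "\<And>y. y \<in> ball w (R / 4) \<Longrightarrow> l y \<noteq> 0 \<Longrightarrow> cmod (G y - c - L (y - w)) \<le> K * (norm (y - w))\<^sup>2"
proof -
  let ?P = "{y. l y \<noteq> 0}"
  have "\<exists>x. (\<forall>n. x n \<in> ?P \<inter> ball w (R / 4)) \<and> x \<longlonglongrightarrow> w"
  proof -
    have "w \<in> closure (ball w (R / 4) \<inter> ?P)"
      using dense_nonzero[OF lin sc e, of w] R
        open_Int_closure_subset[of "ball w (R / 4)" ?P] by auto
    then show ?thesis unfolding closure_sequential by blast
  qed
  then obtain x where x: "\<And>n. l (x n) \<noteq> 0" "\<And>n. x n \<in> ball w (R / 4)" "x \<longlonglongrightarrow> w" by blast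
  \<comment> \<open>Derivatives are represented by gradient vectors, which live in a space with compact balls.\<close>
  define a where "a n = (\<chi> i. frechet_derivative G (at (x n)) (axis i 1))" for n
  have xR: "x n \<in> ball w R - {x. l x = 0}" for n using x(1,2)[of n] R by auto
  have da: "frechet_derivative G (at (x n)) h = (\<Sum>i\<in>UNIV. a n $ i * h $ i)" for n h
    unfolding a_def vec_lambda_beta
    by (rule complex_linear_expansion[OF has_derivative_linear[OF hol_onD(1)[OF hol xR[of n]]]
      hol_onD(2)[OF hol xR[of n]]])
  have na: "norm (a n) \<le> norm (\<chi> i::'i. complex_of_real (8 * M / (3 * R)))" for n
  proof (rule norm_le_componentwise_cart)
    fix i :: 'i
    have "cmod (a n $ i) \<le> 8 * M / (3 * R)"
      using taylor_off_hyperplane(1)[where h = "axis i 1", OF lin sc hol M R x(2)[of n] x(1)[of n]]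
      by (simp add: a_def norm_axis_1)
    also have "\<dots> \<le> norm (complex_of_real (8 * M / (3 * R)))"
      by (simp only: norm_of_real abs_ge_self)
    finally show "norm (a n $ i) \<le> norm ((\<chi> i::'i. complex_of_real (8 * M / (3 * R))) $ i)"
      by (simp only: vec_lambda_beta)
  qed
  have nG: "norm (G (x n)) \<le> M" for n using M xR[of n] by auto
  have nP: "norm (G (x n), a n) \<le> M + norm (\<chi> i::'i. complex_of_real (8 * M / (3 * R)))" for n
    using norm_Pair_le[of "G (x n)" "a n"] na[of n] nG[of n] by linarith
  have "bounded (range (\<lambda>n. (G (x n), a n)))"
    by (rule boundedI[of _ "M + norm (\<chi> i::'i. complex_of_real (8 * M / (3 * R)))"], erule rangeE) (simp only: nP)
  then obtain cA \<phi> where \<phi>: "strict_mono (\<phi> :: nat \<Rightarrow> nat)" "((\<lambda>n. (G (x n), a n)) \<circ> \<phi>) \<longlonglongrightarrow> cA"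
    using bounded_imp_convergent_subsequence by blast
  define c A where "c = fst cA" and "A = snd cA"
  have Gc: "(\<lambda>n. G (x (\<phi> n))) \<longlonglongrightarrow> c" and aA: "(\<lambda>n. a (\<phi> n)) \<longlonglongrightarrow> A"
    using tendsto_fst[OF \<phi>(2)] tendsto_snd[OF \<phi>(2)] by (simp_all add: c_def A_def o_def)
  have xw: "(\<lambda>n. x (\<phi> n)) \<longlonglongrightarrow> w" using LIMSEQ_subseq_LIMSEQ[OF x(3) \<phi>(1)] by (simp add: o_def)
  define L where "L h = (\<Sum>i\<in>UNIV. A $ i * h $ i)" for h
  show thesis
  proof
    have "linear L" unfolding L_def
      by (rule linearI) (auto simp: algebra_simps sum.distrib scaleR_sum_right)
    then show "bounded_linear L" by (simp add: linear_conv_bounded_linear)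
    show "L (c *s h) = c * L h" for c h
      by (simp add: L_def sum_distrib_left algebra_simps)
    fix y assume y: "y \<in> ball w (R / 4)" "l y \<noteq> 0"
    have "(\<lambda>n. cmod (G y - G (x (\<phi> n)) - (\<Sum>i\<in>UNIV. a (\<phi> n) $ i * (y - x (\<phi> n)) $ i)))
        \<longlonglongrightarrow> cmod (G y - c - (\<Sum>i\<in>UNIV. A $ i * (y - w) $ i))"
      by (intro tendsto_intros Gc aA xw)
    moreover have "(\<lambda>n. 64 * M / (9 * R\<^sup>2) * (norm (y - x (\<phi> n)))\<^sup>2) \<longlonglongrightarrow> 64 * M / (9 * R\<^sup>2) * (norm (y - w))\<^sup>2"
      by (intro tendsto_intros xw)
    ultimately show "cmod (G y - c - L (y - w)) \<le> 64 * M / (9 * R\<^sup>2) * (norm (y - w))\<^sup>2"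
      unfolding L_def
    proof (rule LIMSEQ_le, intro exI allI impI)
      fix n
      show "cmod (G y - G (x (\<phi> n)) - (\<Sum>i\<in>UNIV. a (\<phi> n) $ i * (y - x (\<phi> n)) $ i))
        \<le> 64 * M / (9 * R\<^sup>2) * (norm (y - x (\<phi> n)))\<^sup>2"
        using taylor_off_hyperplane(2)[OF lin sc hol M R x(2)[of "\<phi> n"] x(1)[of "\<phi> n"] y] by (simp add: da)
    qed
  qed
qed

text \<open>The extension takes the constant terms of the expansions as values on the hyperplane. Those are limits
  of \<open>G\<close>, so the expansion at \<open>w\<close> remains true at the other points of the hyperplane near \<open>w\<close>, and an
  expansion with quadratic error is differentiability at \<open>w\<close>.\<close>

theorem riemann_extension_hyperplane:
  fixes l :: "complex ^ 'i \<Rightarrow> complex"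
  assumes lin: "linear l" and sc: "\<And>c h. l (c *s h) = c * l h" and e: "l e \<noteq> 0"
    and W: "open W" and hol: "hol_on G (W - {x. l x = 0})"
    and bd: "\<And>w. w \<in> W \<Longrightarrow> l w = 0 \<Longrightarrow> \<exists>R>0. \<exists>M. \<forall>x\<in>ball w R. l x \<noteq> 0 \<longrightarrow> cmod (G x) \<le> M"
  obtains G' where "hol_on G' W" "\<And>x. x \<in> W \<Longrightarrow> l x \<noteq> 0 \<Longrightarrow> G' x = G x"
proof -
  define expansion where "expansion w c L r K \<longleftrightarrow> r > 0 \<and> ball w r \<subseteq> W \<and> bounded_linear L \<and>
      (\<forall>c h. L (c *s h) = c * L h) \<and>
      (\<forall>y\<in>ball w r. l y \<noteq> 0 \<longrightarrow> cmod (G y - c - L (y - w)) \<le> K * (norm (y - w))\<^sup>2)"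
    for w :: "complex ^ 'i" and c L r K
  have "\<exists>c. \<exists>L r K. expansion w c L r K" if w: "w \<in> W" "l w = 0" for w
  proof -
    obtain R M where RM: "R > 0" "\<And>x. x \<in> ball w R \<Longrightarrow> l x \<noteq> 0 \<Longrightarrow> cmod (G x) \<le> M"
      using bd[OF w] by blast
    obtain R' where R': "R' > 0" "ball w R' \<subseteq> W" using W w(1) open_contains_ball by blast
    define r where "r = min R R'"
    have r: "r > 0" "ball w r \<subseteq> W" "ball w r \<subseteq> ball w R" using RM(1) R' by (auto simp: r_def)
    have hol': "hol_on G (ball w r - {x. l x = 0})" by (rule hol_on_subset[OF hol]) (use r(2) in auto)
    have M': "cmod (G x) \<le> M" if "x \<in> ball w r" "l x \<noteq> 0" for x using RM(2) r(3) that by blast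
    obtain c L K where "bounded_linear L" "\<And>c h. L (c *s h) = c * L h"
      "\<And>y. y \<in> ball w (r / 4) \<Longrightarrow> l y \<noteq> 0 \<Longrightarrow> cmod (G y - c - L (y - w)) \<le> K * (norm (y - w))\<^sup>2"
      using limit_expansion_on_hyperplane[OF lin sc e hol' M' r(1) w(2)] by metis
    then have "expansion w c L (r / 4) K"
      using r(1) r(2) unfolding expansion_def by (auto simp: subset_iff)
    then show ?thesis by blast
  qed
  then obtain c where c: "\<And>w. w \<in> W \<Longrightarrow> l w = 0 \<Longrightarrow> \<exists>L r K. expansion w (c w) L r K"
    by metis
  have lim: "(G \<longlongrightarrow> c y) (at y within {z. l z \<noteq> 0})" if y: "y \<in> W" "l y = 0" for y
  proof -
    obtain L r K where ex: "expansion y (c y) L r K" using c[OF y] by blast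
    have L: "bounded_linear L" using ex by (simp add: expansion_def)
    have "((\<lambda>z. G z - c y - L (z - y)) \<longlongrightarrow> 0) (at y within {z. l z \<noteq> 0})"
    proof (rule Lim_null_comparison)
      show "\<forall>\<^sub>F z in at y within {z. l z \<noteq> 0}. norm (G z - c y - L (z - y)) \<le> K * (norm (z - y))\<^sup>2"
        unfolding eventually_at using ex by (intro exI[of _ r]) (auto simp: expansion_def dist_commute)
      have "((\<lambda>z. K * (norm (z - y))\<^sup>2) \<longlongrightarrow> K * (norm (y - y))\<^sup>2) (at y within {z. l z \<noteq> 0})"
        by (intro tendsto_intros)
      then show "((\<lambda>z. K * (norm (z - y))\<^sup>2) \<longlongrightarrow> 0) (at y within {z. l z \<noteq> 0})" by simp
    qed
    moreover have "((\<lambda>z. c y + L (z - y)) \<longlongrightarrow> c y + L (y - y)) (at y within {z. l z \<noteq> 0})"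
      by (intro tendsto_intros bounded_linear.tendsto[OF L])
    ultimately have "((\<lambda>z. (G z - c y - L (z - y)) + (c y + L (z - y))) \<longlongrightarrow> 0 + (c y + L (y - y))) (at y within {z. l z \<noteq> 0})"
      by (rule tendsto_add)
    then show ?thesis using linear_0[OF bounded_linear.linear[OF L]] by simp
  qed
  define G' where "G' x = (if l x = 0 then c x else G x)" for x
  have est: "cmod (G' y - c w - L (y - w)) \<le> K * (norm (y - w))\<^sup>2"
    if ex: "expansion w (c w) L r K" and y: "y \<in> ball w r" for w L r K y
  proof (cases "l y = 0")
    case False then show ?thesis using ex y by (simp add: expansion_def G'_def)
  next
    case True
    have yW: "y \<in> W" and L: "bounded_linear L" using ex y by (auto simp: expansion_def)
    have "at y within {z. l z \<noteq> 0} \<noteq> bot"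
      using dense_nonzero[OF lin sc e, of y] True by (simp add: trivial_limit_within closure_def)
    moreover have "((\<lambda>z. K * (norm (z - w))\<^sup>2) \<longlongrightarrow> K * (norm (y - w))\<^sup>2) (at y within {z. l z \<noteq> 0})"
      by (intro tendsto_intros)
    moreover have "((\<lambda>z. cmod (G z - c w - L (z - w))) \<longlongrightarrow> cmod (c y - c w - L (y - w))) (at y within {z. l z \<noteq> 0})"
      by (intro tendsto_intros lim[OF yW True] bounded_linear.tendsto[OF L])
    moreover have "\<forall>\<^sub>F z in at y within {z. l z \<noteq> 0}. cmod (G z - c w - L (z - w)) \<le> K * (norm (z - w))\<^sup>2"
    proof -
      have "\<forall>\<^sub>F z in at y within {z. l z \<noteq> 0}. z \<in> ball w r"
        using y by (intro eventually_at_topological[THEN iffD2] exI[of _ "ball w r"]) auto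
      moreover have "\<forall>\<^sub>F z in at y within {z. l z \<noteq> 0}. l z \<noteq> 0"
        by (simp add: eventually_at_filter)
      ultimately show ?thesis by eventually_elim (use ex in \<open>auto simp: expansion_def\<close>)
    qed
    ultimately have "cmod (c y - c w - L (y - w)) \<le> K * (norm (y - w))\<^sup>2" by (rule tendsto_le)
    then show ?thesis using True by (simp add: G'_def)
  qed
  show thesis
  proof
    have "continuous_on UNIV l"
      using lin by (simp add: linear_continuous_on linear_conv_bounded_linear)
    then have "closed {x. l x = 0}" by (simp add: closed_Collect_eq)
    then have oP: "open (W - {x. l x = 0})" using W by (rule open_Diff[rotated])
    have off: "hol_on G' (W - {x. l x = 0})"
      by (rule hol_on_cong_open[OF oP _ hol]) (simp add: G'_def)
    show "hol_on G' W"
    proof (rule hol_on_local)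
      fix w assume w: "w \<in> W"
      show "\<exists>V. w \<in> V \<and> hol_on G' V"
      proof (cases "l w = 0")
        case False then show ?thesis using off w by (intro exI[of _ "W - {x. l x = 0}"]) simp
      next
        case True
        obtain L r K where ex: "expansion w (c w) L r K" using c[OF w True] by blast
        have cw: "G' w = c w" using True by (simp add: G'_def)
        have "(G' has_derivative L) (at w)"
        proof (rule has_derivativeI_sandwich[of r _ _ _ _ "\<lambda>y. K * norm (y - w)"])
          show "r > 0" "bounded_linear L" using ex by (auto simp: expansion_def)
          have "((\<lambda>y. K * norm (y - w)) \<longlongrightarrow> K * norm (w - w)) (at w)" by (intro tendsto_intros)
          then show "((\<lambda>y. K * norm (y - w)) \<longlongrightarrow> 0) (at w)" by simp
          fix y assume "y \<noteq> w" "dist y w < r"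
          then show "norm (G' y - G' w - L (y - w)) / norm (y - w) \<le> K * norm (y - w)"
            using est[OF ex, of y] by (simp add: cw dist_commute field_simps power2_eq_square)
        qed
        moreover have "L (c *s h) = c * L h" for c h using ex unfolding expansion_def by blast
        ultimately have "hol_on G' {w}" by (intro hol_onI[where L = "\<lambda>_. L"]) simp_all
        then show ?thesis by (intro exI[of _ "{w}"]) simp
      qed
    qed
  qed (simp add: G'_def)
qed

text \<open>On a line in direction \<open>e\<close> the function \<open>S\<close> vanishes where \<open>l\<close> does, so the quotient \<open>S / l\<close> is a difference
  quotient in one variable. This bounds it near the hyperplane, and Riemann extension applies. The value of
  the quotient on the hyperplane comes from the product rule.\<close>

corollary hyperplane_division:
  fixes l :: "complex ^ 'i \<Rightarrow> complex"
  assumes lin: "linear l" and sc: "\<And>c h. l (c *s h) = c * l h" and e: "l e = 1"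
    and W: "open W" and hol: "hol_on S W" and zero: "\<And>x. x \<in> W \<Longrightarrow> l x = 0 \<Longrightarrow> S x = 0"
  obtains G where "hol_on G W" "\<And>x. x \<in> W \<Longrightarrow> S x = l x * G x"
    "\<And>x. x \<in> W \<Longrightarrow> l x = 0 \<Longrightarrow> G x = frechet_derivative S (at x) e"
proof -
  have bl: "bounded_linear l" using lin by (simp add: linear_conv_bounded_linear)
  have hl: "hol_on l U" for U
    by (rule hol_onI[where L = "\<lambda>x. l"]) (auto simp: sc intro: bounded_linear_imp_has_derivative bl)
  have hG: "hol_on (\<lambda>x. S x / l x) (W - {x. l x = 0})"
    by (rule hol_on_divide) (auto intro: hol_on_subset[OF hol] hl)
  have bd: "\<exists>R>0. \<exists>M. \<forall>x\<in>ball w R. l x \<noteq> 0 \<longrightarrow> cmod (S x / l x) \<le> M" if w: "w \<in> W" "l w = 0" for w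
  proof -
    have "isCont S w" using hol_onD(1)[OF hol w(1)] by (rule has_derivative_continuous)
    then have "(S \<longlongrightarrow> S w) (nhds w)" by (simp add: isCont_def tendsto_at_iff_tendsto_nhds)
    then have "eventually (\<lambda>x. dist (S x) (S w) < 1) (nhds w)" by (rule tendstoD) simp
    then obtain R1 where R1: "R1 > 0" "\<And>x. dist x w < R1 \<Longrightarrow> dist (S x) (S w) < 1"
      unfolding eventually_nhds_metric by blast
    obtain R2 where R2: "R2 > 0" "ball w R2 \<subseteq> W" using W w(1) open_contains_ball by blast
    define R where "R = min R1 R2"
    have R: "R > 0" "ball w R \<subseteq> W" "\<And>x. x \<in> ball w R \<Longrightarrow> cmod (S x) \<le> 1"
      using R1 R2 zero[OF w] by (auto simp: R_def dist_commute less_imp_le)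
    have e0: "norm e > 0" using e linear_0[OF lin] by auto
    obtain K where K: "K > 0" "\<And>h. cmod (l h) \<le> norm h * K"
      using bounded_linear.pos_bounded[OF bl] by blast
    \<comment> \<open>For \<open>x\<close> within \<open>\<delta>\<close> of \<open>w\<close>, the projection \<open>x'\<close> of \<open>x\<close> to the hyperplane along \<open>e\<close> is within \<open>R / 2\<close> of
      \<open>w\<close>, and the disc of radius \<open>\<rho>\<close> in direction \<open>e\<close> about it contains \<open>x\<close> and lies in the ball of radius \<open>R\<close>.\<close>
    define \<delta> where "\<delta> = R / (2 * (1 + K * norm e))"
    define \<rho> where "\<rho> = R / (2 * norm e)"
    have Ke: "1 + K * norm e > 0" using K(1) e0 by (simp add: add_pos_pos)
    have \<delta>: "\<delta> > 0" "\<delta> * (1 + K * norm e) = R / 2" and \<rho>: "\<rho> > 0"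
      using R(1) Ke e0 by (auto simp: \<delta>_def \<rho>_def field_simps)
    have "cmod (S x / l x) \<le> 2 * 1 / \<rho>" if x: "x \<in> ball w \<delta>" "l x \<noteq> 0" for x
    proof -
      define x' where "x' = x - l x *s e"
      have lx': "l x' = 0" by (simp add: x'_def linear_diff[OF lin] sc e)
      have nx: "norm (x - w) < \<delta>" using x(1) by (simp add: dist_norm norm_minus_commute)
      have ls: "cmod (l x) \<le> norm (x - w) * K"
        using K(2)[of "x - w"] w(2) by (simp add: linear_diff[OF lin])
      have "cmod (l x) * norm e \<le> norm (x - w) * K * norm e"
        using ls by (simp add: mult_right_mono)
      also have "\<dots> \<le> \<delta> * (K * norm e)"
        using nx K(1) by (simp add: mult.assoc mult_right_mono)
      finally have le: "cmod (l x) * norm e \<le> \<delta> * (K * norm e)" .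
      then have "cmod (l x) * norm e < R / 2" using \<delta> by (simp add: algebra_simps)
      then have s: "l x \<in> ball 0 \<rho>" using e0 by (simp add: \<rho>_def field_simps)
      have "norm (x' - w) \<le> norm (x - w) + cmod (l x) * norm e"
        using norm_triangle_ineq4[of "x - w" "l x *s e"] by (simp add: x'_def norm_vector_smult algebra_simps)
      then have x'w: "norm (x' - w) < R / 2" using le nx \<delta>(2) by (simp add: algebra_simps)
      have bl: "x' + u *s e \<in> ball w R" if "u \<in> ball 0 \<rho>" for u
      proof -
        have "cmod u * norm e < R / 2" using that e0 by (simp add: \<rho>_def field_simps)
        then have "norm ((x' - w) + u *s e) < R"
          using norm_triangle_ineq[of "x' - w" "u *s e"] x'w by (simp add: norm_vector_smult)
        then show ?thesis by (simp add: dist_norm norm_minus_commute algebra_simps)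
      qed
      have "x' \<in> W" using bl[of 0] \<rho> R(2) by auto
      then have z: "S x' = 0" using zero lx' by simp
      have g: "(\<lambda>u. S (x' + u *s e)) holomorphic_on ball 0 \<rho>"
        using bl R(2) by (intro hol_on_line_holomorphic[OF hol]) auto
      have "x' + l x *s e = x" by (simp add: x'_def)
      then show ?thesis
        using difference_quotient_bound(2)[OF g _ \<rho> s, of 1] R(3)[OF bl] x(2) z by simp
    qed
    then show ?thesis using \<delta>(1) by blast
  qed
  have e': "l e \<noteq> 0" using e by simp
  obtain G where G: "hol_on G W" "\<And>x. x \<in> W \<Longrightarrow> l x \<noteq> 0 \<Longrightarrow> G x = S x / l x"
    using riemann_extension_hyperplane[OF lin sc e' W hG bd] by metis
  have SG: "S x = l x * G x" if "x \<in> W" for x using G(2)[OF that] zero[OF that] by (cases "l x = 0") auto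
  have "G x = frechet_derivative S (at x) e" if x: "x \<in> W" "l x = 0" for x
  proof -
    have "((\<lambda>x. l x * G x) has_derivative (\<lambda>h. l x * frechet_derivative G (at x) h + l h * G x)) (at x)"
      by (rule has_derivative_mult[OF bounded_linear_imp_has_derivative[OF bl] hol_onD(1)[OF G(1) x(1)]])
    then have "(S has_derivative (\<lambda>h. l x * frechet_derivative G (at x) h + l h * G x)) (at x)"
      by (rule has_derivative_transform_within_open[OF _ W x(1)]) (simp add: SG)
    from frechet_derivative_at[OF this, symmetric] show ?thesis using x(2) e by simp
  qed
  then show thesis using that G(1) SG by blast
qed

section \<open>Normal forms of meromorphic functions\<close>

definition open_dense :: "'a::topological_space set \<Rightarrow> 'a set \<Rightarrow> bool" where
  "open_dense W U \<longleftrightarrow> open U \<and> U \<subseteq> W \<and> W \<subseteq> closure U"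

lemma open_dense_restrict:
  assumes "open_dense W U" "open N" "N \<subseteq> W"
  shows "open_dense N (N \<inter> U)"
  using assms open_Int_closure_subset[of N U] unfolding open_dense_def by blast

lemma open_dense_trans: "open_dense W U \<Longrightarrow> open_dense U V \<Longrightarrow> open_dense W V"
  unfolding open_dense_def by (meson closure_minimal closed_closure order_trans)

lemma open_dense_Int:
  assumes "open_dense W U" "open_dense W V" shows "open_dense W (U \<inter> V)"
  using open_dense_trans[OF assms(1) open_dense_restrict[OF assms(2)]] assms(1)
  by (simp add: open_dense_def)

lemma open_dense_refl: "open W \<Longrightarrow> open_dense W W"
  by (simp add: open_dense_def closure_subset)

lemma open_dense_iff_thin_complement:
  assumes "open N" "open U" "U \<subseteq> N"
  shows "open_dense N U \<longleftrightarrow> interior (N - U) = {}"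
proof
  assume d: "open_dense N U"
  show "interior (N - U) = {}"
  proof (rule ccontr)
    assume "interior (N - U) \<noteq> {}"
    then obtain y where y: "y \<in> interior (N - U)" by blast
    then have "y \<in> closure U" using d interior_subset unfolding open_dense_def by blast
    then have "interior (N - U) \<inter> U \<noteq> {}"
      using y open_Int_closure_eq_empty[OF open_interior, of "N - U" U] by blast
    then show False using interior_subset by blast
  qed
next
  assume i: "interior (N - U) = {}"
  have "N - closure U \<subseteq> interior (N - U)"
    using assms closure_subset[of U] by (intro interior_maximal) (auto simp: open_Diff)
  then show "open_dense N U" using assms i by (auto simp: open_dense_def)
qed

lemma open_nonzero:
  fixes h :: "complex ^ 'i \<Rightarrow> complex"
  assumes "open N" "hol_on h N" shows "open {y \<in> N. h y \<noteq> 0}"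
proof -
  have "open (h -` (- {0}) \<inter> N)"
    using continuous_on_open_vimage[OF assms(1)] hol_on_imp_continuous_on[OF assms(2)] by blast
  moreover have "h -` (- {0}) \<inter> N = {y \<in> N. h y \<noteq> 0}" by auto
  ultimately show ?thesis by simp
qed

lemma thin_zeros_iff:
  fixes h :: "complex ^ 'i \<Rightarrow> complex"
  assumes "open N" "hol_on h N"
  shows "interior {y \<in> N. h y = 0} = {} \<longleftrightarrow> open_dense N {y \<in> N. h y \<noteq> 0}"
proof -
  have "N - {y \<in> N. h y \<noteq> 0} = {y \<in> N. h y = 0}" by auto
  then show ?thesis using open_dense_iff_thin_complement[OF assms(1) open_nonzero[OF assms]] by auto
qed

lemma reg_eqI:
  assumes "open N" "x \<in> N" "N \<subseteq> W" "hol_on F N" "open_dense N U" "\<And>y. y \<in> U \<Longrightarrow> f y = F y"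
  shows "reg W f x = F x"
proof -
  have "U \<subseteq> interior {y \<in> N. f y = F y}"
    using assms by (intro interior_maximal) (auto simp: open_dense_def)
  then have "generically_eq N f F"
    using assms(5) closure_mono unfolding generically_eq_def open_dense_def by blast
  then have "regular_value W f x (F x)" unfolding regular_value_def using assms by blast
  then show ?thesis unfolding reg_def using regular_value_unique by (metis the_equality)
qed

lemma reg_hol: "open U \<Longrightarrow> hol_on f U \<Longrightarrow> U \<subseteq> W \<Longrightarrow> x \<in> U \<Longrightarrow> reg W f x = f x"
  by (rule reg_eqI[OF _ _ _ _ open_dense_refl]) auto

lemma reg_outside: "x \<notin> W \<Longrightarrow> reg W f x = 0"
  by (auto simp: reg_def regular_value_def)

lemma regular_value_cong:
  assumes U: "open_dense W U" and fg: "\<And>y. y \<in> U \<Longrightarrow> f y = g y" and r: "regular_value W f x c"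
  shows "regular_value W g x c"
proof -
  obtain N F where N: "open N" "x \<in> N" "N \<subseteq> W" "hol_on F N" "generically_eq N f F" "F x = c"
    using r by (auto simp: regular_value_def)
  let ?I = "interior {y \<in> N. f y = F y}"
  have I: "open_dense N ?I"
    using N(5) interior_subset by (auto simp: open_dense_def generically_eq_def)
  then have "open_dense N (?I \<inter> (N \<inter> U))"
    using open_dense_Int open_dense_restrict[OF U N(1,3)] by blast
  moreover have "?I \<inter> (N \<inter> U) \<subseteq> interior {y \<in> N. g y = F y}"
    using U N(1) fg interior_subset[of "{y \<in> N. f y = F y}"]
    by (intro interior_maximal) (auto simp: open_dense_def)
  ultimately have "generically_eq N g F"
    using closure_mono unfolding generically_eq_def open_dense_def by blast
  then show ?thesis using N unfolding regular_value_def by blast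
qed

lemma reg_cong:
  assumes "open_dense W U" "\<And>y. y \<in> U \<Longrightarrow> f y = g y"
  shows "reg W f = reg W g"
proof -
  have "regular_value W f = regular_value W g"
    by (intro ext iffI; rule regular_value_cong[OF assms(1)]) (simp_all add: assms(2))
  then show ?thesis unfolding reg_def by (simp cong: if_cong)
qed

lemma reg_eq_hol:
  assumes "open W" "open_dense W U" "\<And>y. y \<in> U \<Longrightarrow> f y = F y" "hol_on F W" "\<And>y. y \<notin> W \<Longrightarrow> F y = 0"
  shows "reg W f = F"
proof
  fix x show "reg W f x = F x"
    using reg_eqI[of W x W F U f] assms reg_outside by (cases "x \<in> W") auto
qed

lemma reg_reg:
  assumes "open_dense W U" "hol_on f U"
  shows "reg W (reg W f) = reg W f"
  by (rule reg_cong[OF assms(1)]) (use assms in \<open>auto simp: open_dense_def intro: reg_hol[of U]\<close>)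

lemma hol_on_reg:
  assumes "open U" "hol_on f U" "U \<subseteq> W"
  shows "hol_on (reg W f) U"
  by (rule hol_on_cong_open[OF assms(1) _ assms(2)]) (simp add: reg_hol[OF assms])

lemma mero_onE:
  assumes "mero_on f U" "x \<in> U"
  obtains N g h where "open N" "x \<in> N" "N \<subseteq> U" "hol_on g N" "hol_on h N"
    "open_dense N {y \<in> N. h y \<noteq> 0}" "\<And>y. y \<in> N \<Longrightarrow> h y \<noteq> 0 \<Longrightarrow> f y = g y / h y"
proof -
  obtain N g h where N: "open N" "x \<in> N" "N \<subseteq> U" "hol_on g N" "hol_on h N"
    and z: "interior {y \<in> N. h y = 0} = {}" and f: "\<forall>y\<in>N. h y \<noteq> 0 \<longrightarrow> f y = g y / h y"
    using bspec[OF assms(1)[unfolded mero_on_def] assms(2)] by (elim exE conjE)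
  show thesis by (rule that[OF N thin_zeros_iff[OF N(1,5), THEN iffD1, OF z]]) (simp add: f)
qed

lemma mero_onI:
  assumes "\<And>x. x \<in> U \<Longrightarrow> \<exists>N g h. open N \<and> x \<in> N \<and> N \<subseteq> U \<and> hol_on g N \<and> hol_on h N \<and>
    open_dense N {y \<in> N. h y \<noteq> 0} \<and> (\<forall>y\<in>N. h y \<noteq> 0 \<longrightarrow> f y = g y / h y)"
  shows "mero_on f U"
  unfolding mero_on_def
proof
  fix x assume x: "x \<in> U"
  obtain N g h where N: "open N" "x \<in> N" "N \<subseteq> U" "hol_on g N" "hol_on h N"
    "open_dense N {y \<in> N. h y \<noteq> 0}" "\<forall>y\<in>N. h y \<noteq> 0 \<longrightarrow> f y = g y / h y"
    using assms[OF x] by (elim exE conjE)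
  show "\<exists>N g h. open N \<and> x \<in> N \<and> N \<subseteq> U \<and> hol_on g N \<and> hol_on h N \<and>
        interior {y \<in> N. h y = 0} = {} \<and> (\<forall>y\<in>N. h y \<noteq> 0 \<longrightarrow> f y = g y / h y)"
    by (intro exI[of _ N] exI[of _ g] exI[of _ h] conjI N thin_zeros_iff[OF N(1,5), THEN iffD2])
qed

lemma mero_on_quotient:
  assumes "open U" "hol_on g U" "hol_on h U" "open_dense U {y \<in> U. h y \<noteq> 0}"
  shows "mero_on (\<lambda>x. g x / h x) U"
  by (rule mero_onI, rule exI[of _ U]) (use assms in blast)

lemma mero_on_hol:
  assumes "open U" "hol_on f U" shows "mero_on f U"
  using mero_on_quotient[OF assms hol_on_const[of 1]] open_dense_refl[OF assms(1)] by simp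

text \<open>Sums and products of quotients both have the product of the two denominators as a denominator, and two
  open dense sets meet in an open dense set; \<open>num\<close> is the numerator that results.\<close>

lemma mero_on_combine:
  fixes f f' :: "complex ^ 'i \<Rightarrow> complex"
  assumes "mero_on f U" "mero_on f' U"
    and op: "\<And>g h g' h' (N :: (complex ^ 'i) set). hol_on g N \<Longrightarrow> hol_on g' N \<Longrightarrow> hol_on h N \<Longrightarrow> hol_on h' N \<Longrightarrow>
        hol_on (\<lambda>y. num (g y) (h y) (g' y) (h' y)) N"
    and q: "\<And>a b c d. b \<noteq> 0 \<Longrightarrow> d \<noteq> 0 \<Longrightarrow> F (a / b) (c / d) = num a b c d / (b * d)"
  shows "mero_on (\<lambda>x. F (f x) (f' x)) U"
proof (rule mero_onI)
  fix x assume x: "x \<in> U"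
  obtain N g h where N: "open N" "x \<in> N" "N \<subseteq> U" "hol_on g N" "hol_on h N"
    "open_dense N {y \<in> N. h y \<noteq> 0}" "\<And>y. y \<in> N \<Longrightarrow> h y \<noteq> 0 \<Longrightarrow> f y = g y / h y"
    using mero_onE[OF assms(1) x] by blast
  obtain N' g' h' where N': "open N'" "x \<in> N'" "N' \<subseteq> U" "hol_on g' N'" "hol_on h' N'"
    "open_dense N' {y \<in> N'. h' y \<noteq> 0}" "\<And>y. y \<in> N' \<Longrightarrow> h' y \<noteq> 0 \<Longrightarrow> f' y = g' y / h' y"
    using mero_onE[OF assms(2) x] by blast
  let ?M = "N \<inter> N'"
  have M: "open ?M" "hol_on g ?M" "hol_on h ?M" "hol_on g' ?M" "hol_on h' ?M"
    using N N' by (auto intro: hol_on_subset)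
  have "open_dense ?M ((?M \<inter> {y \<in> N. h y \<noteq> 0}) \<inter> (?M \<inter> {y \<in> N'. h' y \<noteq> 0}))"
    using M(1) by (intro open_dense_Int open_dense_restrict[OF N(6)] open_dense_restrict[OF N'(6)]) auto
  moreover have "(?M \<inter> {y \<in> N. h y \<noteq> 0}) \<inter> (?M \<inter> {y \<in> N'. h' y \<noteq> 0}) = {y \<in> ?M. h y * h' y \<noteq> 0}" by auto
  ultimately have "open_dense ?M {y \<in> ?M. h y * h' y \<noteq> 0}" by simp
  moreover have "F (f y) (f' y) = num (g y) (h y) (g' y) (h' y) / (h y * h' y)" if "y \<in> ?M" "h y * h' y \<noteq> 0" for y
    using that N(7)[of y] N'(7)[of y] q by simp
  ultimately show "\<exists>N G H. open N \<and> x \<in> N \<and> N \<subseteq> U \<and> hol_on G N \<and> hol_on H N \<and>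
    open_dense N {y \<in> N. H y \<noteq> 0} \<and> (\<forall>y\<in>N. H y \<noteq> 0 \<longrightarrow> F (f y) (f' y) = G y / H y)"
    using M N N' op[OF M(2,4,3,5)] hol_on_mult[OF M(3,5)]
    by (intro exI[of _ ?M] exI[of _ "\<lambda>y. num (g y) (h y) (g' y) (h' y)"] exI[of _ "\<lambda>y. h y * h' y"]) auto
qed

lemma mero_on_add: "mero_on f U \<Longrightarrow> mero_on g U \<Longrightarrow> mero_on (\<lambda>x. f x + g x) U"
  by (rule mero_on_combine[where F = "(+)" and num = "\<lambda>a b c d. a * d + c * b"])
    (auto intro!: hol_on_add hol_on_mult simp: field_simps)

lemma mero_on_mult: "mero_on f U \<Longrightarrow> mero_on g U \<Longrightarrow> mero_on (\<lambda>x. f x * g x) U"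
  by (rule mero_on_combine[where F = "(*)" and num = "\<lambda>a b c d. a * c"])
    (auto intro!: hol_on_mult)

lemma mero_on_sum:
  assumes "open U" "\<And>i. i \<in> I \<Longrightarrow> mero_on (f i) U" shows "mero_on (\<lambda>x. \<Sum>i\<in>I. f i x) U"
  using assms(2)
  by (induction I rule: infinite_finite_induct) (auto intro: mero_on_add mero_on_hol[OF assms(1) hol_on_const])

lemma mero_on_minus:
  assumes "open U" "mero_on f U" shows "mero_on (\<lambda>x. - f x) U"
  using mero_on_mult[OF mero_on_hol[OF assms(1) hol_on_const[of "-1"]] assms(2)] by simp

lemma mero_on_translate:
  assumes f: "mero_on f U" and T: "\<And>x. x \<in> U \<Longrightarrow> x + c \<in> U" and U: "open U"
  shows "mero_on (\<lambda>x. f (x + c)) U"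
proof (rule mero_onI)
  fix x assume x: "x \<in> U"
  obtain N g h where N: "open N" "x + c \<in> N" "N \<subseteq> U" "hol_on g N" "hol_on h N"
    "open_dense N {y \<in> N. h y \<noteq> 0}" "\<And>y. y \<in> N \<Longrightarrow> h y \<noteq> 0 \<Longrightarrow> f y = g y / h y"
    using mero_onE[OF f T[OF x]] by blast
  define M where "M = U \<inter> (+) (- c) ` N"
  have M: "open M" "x \<in> M" "M \<subseteq> U" "\<And>y. y \<in> M \<Longrightarrow> y + c \<in> N"
    using N(1,2) U x open_translation[OF N(1), of "- c"] by (auto simp: M_def intro!: image_eqI[of _ _ "x + c"])
  have tr: "hol_on (\<lambda>x. k (x + c)) M" if "hol_on k N" for k
    by (rule hol_on_compose_affine(1)[OF that M(4), where M = "\<lambda>h. h"]) (auto intro!: derivative_eq_intros)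
  have "open_dense M {y \<in> M. h (y + c) \<noteq> 0}"
  proof -
    have "interior {y \<in> M. h (y + c) = 0} = {}"
    proof (rule ccontr)
      let ?O = "interior {y \<in> M. h (y + c) = 0}"
      assume "?O \<noteq> {}"
      then have "(+) c ` ?O \<noteq> {}" by simp
      moreover have "(+) c ` ?O \<subseteq> {y \<in> N. h y = 0}"
        using interior_subset[of "{y \<in> M. h (y + c) = 0}"] M(4) by (auto simp: add.commute)
      then have "(+) c ` ?O \<subseteq> interior {y \<in> N. h y = 0}"
        by (rule interior_maximal) (simp add: open_translation)
      ultimately show False using N(6) thin_zeros_iff[OF N(1,5)] by blast
    qed
    then show ?thesis using thin_zeros_iff[OF M(1) tr[OF N(5)]] by simp
  qed
  then show "\<exists>N G H. open N \<and> x \<in> N \<and> N \<subseteq> U \<and> hol_on G N \<and> hol_on H N \<and>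
    open_dense N {y \<in> N. H y \<noteq> 0} \<and> (\<forall>y\<in>N. H y \<noteq> 0 \<longrightarrow> f (y + c) = G y / H y)"
    using M N(7) tr[OF N(4)] tr[OF N(5)]
    by (intro exI[of _ M] exI[of _ "\<lambda>y. g (y + c)"] exI[of _ "\<lambda>y. h (y + c)"]) auto
qed

lemma mero_on_quotient_hol:
  assumes "open N" "hol_on g N" "hol_on h N" "\<And>y. y \<in> N \<Longrightarrow> h y \<noteq> 0 \<Longrightarrow> f y = g y / h y"
  shows "open {y \<in> N. h y \<noteq> 0}" "hol_on f {y \<in> N. h y \<noteq> 0}"
proof -
  show o: "open {y \<in> N. h y \<noteq> 0}" using assms open_nonzero by blast
  have "hol_on (\<lambda>y. g y / h y) {y \<in> N. h y \<noteq> 0}"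
    by (rule hol_on_divide) (auto intro: hol_on_subset assms)
  then show "hol_on f {y \<in> N. h y \<noteq> 0}" by (rule hol_on_cong_open[OF o, rotated]) (simp add: assms)
qed

lemma mero_on_hol_dense:
  assumes "mero_on f W" obtains U where "open_dense W U" "hol_on f U"
proof
  let ?U = "\<Union>{V. open V \<and> V \<subseteq> W \<and> hol_on f V}"
  show "hol_on f ?U" by (rule hol_on_local) blast
  have "x \<in> closure ?U" if x: "x \<in> W" for x
  proof -
    obtain N g h where N: "open N" "x \<in> N" "N \<subseteq> W" "hol_on g N" "hol_on h N"
      "open_dense N {y \<in> N. h y \<noteq> 0}" "\<And>y. y \<in> N \<Longrightarrow> h y \<noteq> 0 \<Longrightarrow> f y = g y / h y"
      using mero_onE[OF assms x] by blast
    have "{y \<in> N. h y \<noteq> 0} \<subseteq> ?U" using mero_on_quotient_hol[OF N(1,4,5,7)] N(3) by blast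
    then show ?thesis using N(2,6) closure_mono unfolding open_dense_def by blast
  qed
  then show "open_dense W ?U" by (auto simp: open_dense_def)
qed

lemma mero_on_reg:
  assumes "mero_on f W" shows "mero_on (reg W f) W"
proof (rule mero_onI)
  fix x assume x: "x \<in> W"
  obtain N g h where N: "open N" "x \<in> N" "N \<subseteq> W" "hol_on g N" "hol_on h N"
    "open_dense N {y \<in> N. h y \<noteq> 0}" "\<And>y. y \<in> N \<Longrightarrow> h y \<noteq> 0 \<Longrightarrow> f y = g y / h y"
    using mero_onE[OF assms x] by blast
  have "reg W f y = g y / h y" if "y \<in> N" "h y \<noteq> 0" for y
    using reg_hol[OF mero_on_quotient_hol[OF N(1,4,5,7)], of W y] N(3,7) that by auto
  then show "\<exists>N G H. open N \<and> x \<in> N \<and> N \<subseteq> W \<and> hol_on G N \<and> hol_on H N \<and>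
    open_dense N {y \<in> N. H y \<noteq> 0} \<and> (\<forall>y\<in>N. H y \<noteq> 0 \<longrightarrow> reg W f y = G y / H y)"
    using N by blast
qed

lemma reg_in_mero:
  assumes "mero_on f W" shows "reg W f \<in> mero W"
proof -
  obtain U where "open_dense W U" "hol_on f U" using mero_on_hol_dense[OF assms] by blast
  then show ?thesis using mero_on_reg[OF assms] by (simp add: mero_def reg_reg)
qed

text \<open>Both functions are holomorphic on a common open dense set, where their sum is its own normal form.
  The statement is needed because negation in the skew group ring is given by a unique description.\<close>

lemma mero_add_inverse_unique:
  assumes "f \<in> mero W" "g \<in> mero W" "reg W (\<lambda>x. f x + g x) = 0"
  shows "g = (\<lambda>x. - f x)"
proof -
  have m: "mero_on f W" "mero_on g W" "reg W f = f" "reg W g = g" using assms by (auto simp: mero_def)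
  obtain U where U: "open_dense W U" "hol_on f U" using mero_on_hol_dense[OF m(1)] by blast
  obtain V where V: "open_dense W V" "hol_on g V" using mero_on_hol_dense[OF m(2)] by blast
  have UV: "open_dense W (U \<inter> V)" using open_dense_Int U(1) V(1) by blast
  then have o: "open (U \<inter> V)" "U \<inter> V \<subseteq> W" by (auto simp: open_dense_def)
  have h: "hol_on f (U \<inter> V)" "hol_on g (U \<inter> V)" using U V by (auto intro: hol_on_subset)
  have "g y = - f y" if "y \<in> U \<inter> V" for y
    using reg_hol[OF o(1) hol_on_add[OF h] o(2) that] assms(3) by (simp add: add_eq_0_iff)
  then have "reg W g = reg W (\<lambda>x. - f x)" by (rule reg_cong[OF UV])
  also have "\<dots> = (\<lambda>x. - reg W f x)"
  proof
    fix x
    have "regular_value W (\<lambda>x. - k x) x (- c)" if r: "regular_value W k x c" for k c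
    proof -
      obtain N F where N: "open N" "x \<in> N" "N \<subseteq> W" "hol_on F N" "generically_eq N k F" "F x = c"
        using r by (auto simp: regular_value_def)
      then have "generically_eq N (\<lambda>x. - k x) (\<lambda>x. - F x)" by (simp add: generically_eq_def)
      then show ?thesis unfolding regular_value_def using N hol_on_minus[OF N(4)] by blast
    qed
    note n = this
    show "reg W (\<lambda>x. - f x) x = - reg W f x"
    proof (cases "\<exists>c. regular_value W f x c")
      case True
      then obtain c where c: "regular_value W f x c" by blast
      have "reg W k x = d" if "regular_value W k x d" for k d
        using that regular_value_unique unfolding reg_def by (metis the_equality)
      then show ?thesis using c n[OF c] by metis
    next
      case False
      then have "\<nexists>c. regular_value W (\<lambda>x. - f x) x c" using n[of "\<lambda>x. - f x"] by auto
      then show ?thesis using False by (simp add: reg_def)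
    qed
  qed
  finally show ?thesis using m by simp
qed

section \<open>Shifts, the transposition and the hyperplane\<close>

lemma shift_eq_plus: "shift m x = x + (\<chi> r. of_int (m r))"
  by (simp add: shift_def vec_eq_iff)

lemma shift_has_derivative: "(shift m has_derivative (\<lambda>h. h)) (at x)"
proof -
  have "shift m = (\<lambda>x. x + (\<chi> r. of_int (m r)))" by (simp add: fun_eq_iff shift_eq_plus)
  then show ?thesis by (auto intro!: derivative_eq_intros)
qed

lemma hol_on_shift:
  assumes "hol_on f U" "\<And>x. x \<in> V \<Longrightarrow> shift m x \<in> U"
  shows "hol_on (\<lambda>x. f (shift m x)) V"
  by (rule hol_on_compose_affine(1)[OF assms shift_has_derivative]) auto

lemma frechet_derivative_shift:
  assumes "hol_on f U" "shift m x \<in> U"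
  shows "frechet_derivative (\<lambda>x. f (shift m x)) (at x) h = frechet_derivative f (at (shift m x)) h"
  using frechet_derivative_at[OF hol_on_compose_affine(2)[OF assms(1), of "{x}" "shift m", OF _ shift_has_derivative]]
    assms(2) by simp

lemma shift_shift: "shift m (shift m' x) = shift (m + m') x"
  by (simp add: shift_add)

lemma shift_zero [simp]: "shift 0 x = x"
  by (simp add: shift_def vec_eq_iff)

lemma shifts_closed [simp]:
  "0 \<in> shifts" "m \<in> shifts \<Longrightarrow> - m \<in> shifts" "m \<in> shifts \<Longrightarrow> m' \<in> shifts \<Longrightarrow> m + m' \<in> shifts"
  by (auto simp: shifts_def)

text \<open>What the argument uses of a 1-singular point and a small neighbourhood of its orbit: invariance of \<open>W\<close>
  under shifts and under the transposition, and a stabilizer generated by the transposition.\<close>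

locale singular_point =
  fixes p q :: "'n::finite pos" and v :: "'n tableau" and W :: "'n tableau set"
  assumes row_pq: "row p = row q" and pq: "p \<noteq> q" and v_zero: "z1 p q v = 0"
    and open_W: "open W" and v_W: "v \<in> W"
    and shift_W: "m \<in> shifts \<Longrightarrow> x \<in> W \<Longrightarrow> shift m x \<in> W"
    and swap_W: "x \<in> W \<Longrightarrow> permute (swap p q) x \<in> W"
    and stab: "stabilizer v = {id, swap p q}"
begin

abbreviation z :: "'n tableau \<Rightarrow> complex" where "z \<equiv> z1 p q"
abbreviation \<tau> :: "'n tableau \<Rightarrow> 'n tableau" where "\<tau> \<equiv> permute (swap p q)"
abbreviation reflect :: "('n pos \<Rightarrow> int) \<Rightarrow> 'n pos \<Rightarrow> int" where "reflect \<equiv> perm_shift (swap p q)"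

text \<open>The direction of the partial derivative with respect to \<open>z\<^sub>1\<close>: along it \<open>z\<^sub>1\<close> grows with slope
  \<open>1\<close> and the other coordinates \<open>z\<^sub>2, z\<^sub>3, \<dots>\<close> are constant.\<close>

definition e :: "'n tableau" where "e = (1 / 2) *s (axis p 1 - axis q 1)"
text \<open>Generators are holomorphic on \<open>W0\<close>. Products involve shifted coefficients, with poles on
  the parallel hyperplanes where \<open>z\<close> is an integer; off all of these lies \<open>Wg\<close>, which, unlike \<open>W0\<close>, is
  invariant under shifts.\<close>

definition W0 :: "'n tableau set" where "W0 = {x \<in> W. z x \<noteq> 0}"
definition Wg :: "'n tableau set" where "Wg = {x \<in> W. z x \<notin> \<int>}"

lemma z_linear: "linear z"
  by (rule linearI) (auto simp: z1_def algebra_simps)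

lemma z_scale: "z (c *s h) = c * z h"
  by (simp add: z1_def algebra_simps)

lemma z_e: "z e = 1"
  using pq by (simp add: z1_def e_def axis_def)

lemma z_bounded_linear: "bounded_linear z"
  using z_linear by (simp add: linear_conv_bounded_linear)

lemma hol_on_z: "hol_on z U"
  by (rule hol_onI[where L = "\<lambda>x. z"]) (auto simp: z_scale intro: bounded_linear_imp_has_derivative z_bounded_linear)

lemma z_shift: "z (shift m x) = z x + of_int (m p - m q)"
  by (simp add: z1_def shift_def)

lemma swap_swap [simp]: "\<tau> (\<tau> x) = x"
  by (simp add: permute_def vec_eq_iff)

lemma z_swap: "z (\<tau> x) = - z x"
  by (simp add: z1_def permute_def)

lemma swap_fixed: "z x = 0 \<Longrightarrow> \<tau> x = x"
  by (auto simp: z1_def permute_def vec_eq_iff Transposition.transpose_def)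

lemma swap_e: "\<tau> e = - e"
  using pq by (auto simp: e_def permute_def vec_eq_iff axis_def Transposition.transpose_def)

lemma swap_bounded_linear: "bounded_linear \<tau>"
proof -
  have "linear \<tau>" by (rule linearI) (auto simp: permute_def vec_eq_iff)
  then show ?thesis by (simp add: linear_conv_bounded_linear)
qed

lemma reflect_reflect [simp]: "reflect (reflect m) = m"
  by (simp add: perm_shift_def fun_eq_iff)

lemma reflect_minus: "reflect (- m) = - reflect m"
  by (simp add: perm_shift_def fun_eq_iff)

lemma reflect_eq_iff: "reflect m = m \<longleftrightarrow> m p = m q"
  by (auto simp: perm_shift_def fun_eq_iff Transposition.transpose_def)

lemma row_swap: "row (swap p q r) = row r"
  using row_pq by (auto simp: Transposition.transpose_def)

lemma reflect_shifts [simp]: "reflect m \<in> shifts \<longleftrightarrow> m \<in> shifts"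
proof -
  have "reflect m \<in> shifts" if "m \<in> shifts" for m
    using that row_swap by (auto simp: shifts_def perm_shift_def)
  from this[of m] this[of "reflect m"] show ?thesis by auto
qed

lemma shift_reflect: "shift (reflect m) (\<tau> x) = \<tau> (shift m x)"
  by (simp add: shift_def permute_def perm_shift_def vec_eq_iff)

lemma swap_W_iff: "\<tau> x \<in> W \<longleftrightarrow> x \<in> W"
  using swap_W[of x] swap_W[of "\<tau> x"] by auto

lemma shift_Wg: "m \<in> shifts \<Longrightarrow> x \<in> Wg \<Longrightarrow> shift m x \<in> Wg"
proof -
  assume m: "m \<in> shifts" and x: "x \<in> Wg"
  have "z x \<in> \<int>" if "z x + of_int (m p - m q) \<in> \<int>"
    using Ints_diff[OF that, of "of_int (m p - m q)"] by simp
  then show ?thesis using m x by (auto simp: Wg_def shift_W z_shift)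
qed

lemma W0_dense: "open_dense W W0"
proof -
  have "open {x. z x \<noteq> 0}"
    using z_bounded_linear by (intro open_Collect_neq) (auto intro: linear_continuous_on)
  moreover have "W \<inter> {x. z x \<noteq> 0} = W0" by (auto simp: W0_def)
  moreover have "W \<subseteq> closure (W \<inter> {x. z x \<noteq> 0})"
    using dense_nonzero[OF z_linear z_scale, of e] z_e open_Int_closure_subset[OF open_W, of "{x. z x \<noteq> 0}"]
    by fastforce
  ultimately show ?thesis using open_W by (metis open_dense_def inf_le1 open_Int)
qed

lemma Wg_dense: "open_dense W Wg"
proof -
  have "open {x. z x \<in> - \<int>}"
  proof -
    have "open (- (\<int> :: complex set))" by (simp add: closed_Ints open_Compl)
    then have "open (z -` (- \<int>))"
      using z_bounded_linear continuous_on_open_vimage[of UNIV z] by (auto intro: linear_continuous_on)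
    moreover have "z -` (- \<int>) = {x. z x \<in> - \<int>}" by auto
    ultimately show ?thesis by simp
  qed
  then have o: "open {x. z x \<notin> \<int>}" by simp
  have near: "\<exists>t. cmod t < r \<and> z x + t * z e \<notin> \<int>" if r: "r > 0" for r :: real and x
  proof (cases "z x \<in> \<int>")
    case True
    define t where "t = min (r / 2) (1 / 2)"
    have t: "0 < t" "t < r" "t < 1" using r by (auto simp: t_def)
    have "complex_of_real t \<notin> \<int>"
    proof
      assume "complex_of_real t \<in> \<int>"
      then obtain k :: int where "complex_of_real t = of_int k" by (elim Ints_cases)
      then have "t = of_int k" using of_real_eq_iff[of t "of_int k", where 'a = complex] by simp
      then have "0 < real_of_int k" "real_of_int k < 1" using t by simp_all
      then show False by simp
    qed
    then have "z x + of_real t \<notin> \<int>" using Ints_diff[of "z x + of_real t" "z x"] True by auto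
    then show ?thesis using t z_e by (intro exI[of _ "of_real t"]) simp
  next
    case False then show ?thesis using r by (intro exI[of _ 0]) simp
  qed
  have ze: "z e \<noteq> 0" by (simp add: z_e)
  have "x \<in> closure {x. z x \<notin> \<int>}" for x
    by (rule dense_off_hyperplane[OF z_linear z_scale ze near])
  then have "W \<subseteq> closure (W \<inter> {x. z x \<notin> \<int>})"
    using open_Int_closure_subset[OF open_W, of "{x. z x \<notin> \<int>}"] by fastforce
  moreover have "W \<inter> {x. z x \<notin> \<int>} = Wg" by (auto simp: Wg_def)
  moreover have "open (W \<inter> {x. z x \<notin> \<int>})" using open_W o by (rule open_Int)
  ultimately show ?thesis by (auto simp: open_dense_def)
qed

lemma Wg_W0: "Wg \<subseteq> W0" by (auto simp: Wg_def W0_def)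
lemma open_Wg: "open Wg" "Wg \<subseteq> W" and open_W0: "open W0" "W0 \<subseteq> W"
  using W0_dense Wg_dense by (auto simp: open_dense_def)

text \<open>Both functions are equal to their normal forms, which do not see nowhere dense sets.\<close>

lemma hol_eq_on_dense:
  assumes "hol_on f W" "hol_on g W" "open_dense W U" "\<And>x. x \<in> U \<Longrightarrow> f x = g x" "x \<in> W"
  shows "f x = g x"
  using reg_hol[OF open_W assms(1) order_refl assms(5)] reg_hol[OF open_W assms(2) order_refl assms(5)]
    reg_cong[OF assms(3,4)] by simp

lemma hol_on_swap:
  assumes "hol_on f W" shows "hol_on (\<lambda>x. f (\<tau> x)) W"
  and "x \<in> W \<Longrightarrow> frechet_derivative (\<lambda>x. f (\<tau> x)) (at x) h = frechet_derivative f (at (\<tau> x)) (\<tau> h)"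
proof -
  note c = hol_on_compose_affine[OF assms, of W \<tau> \<tau>, OF swap_W
      bounded_linear_imp_has_derivative[OF swap_bounded_linear]]
  have s: "\<tau> (c *s h) = c *s \<tau> h" for c h by (simp add: permute_def vec_eq_iff)
  show "hol_on (\<lambda>x. f (\<tau> x)) W" by (rule c(1)) (auto simp: s)
  assume x: "x \<in> W"
  have "((\<lambda>x. f (\<tau> x)) has_derivative (\<lambda>h. frechet_derivative f (at (\<tau> x)) (\<tau> h))) (at x)"
    by (rule c(2)) (auto simp: s x)
  from frechet_derivative_at[OF this]
  show "frechet_derivative (\<lambda>x. f (\<tau> x)) (at x) h = frechet_derivative f (at (\<tau> x)) (\<tau> h)" by metis
qed

section \<open>The action of the skew group ring\<close>

abbreviation inv_hol :: "('n tableau \<Rightarrow> complex) set" where "inv_hol \<equiv> hol_invariants W v"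

lemma inv_swap: "inv_into UNIV (swap p q) = swap p q"
  by simp

lemma inv_hol_iff:
  "F \<in> inv_hol \<longleftrightarrow> hol_on F W \<and> (\<forall>x. x \<notin> W \<longrightarrow> F x = 0) \<and> (\<forall>x. F (\<tau> x) = F x)"
proof -
  have "permute id = (id :: 'n tableau \<Rightarrow> _)" by (simp add: fun_eq_iff permute_def vec_eq_iff)
  then show ?thesis by (auto simp: hol_invariants_def stab fun_eq_iff inv_swap)
qed

lemma inv_holD:
  assumes "F \<in> inv_hol"
  shows "hol_on F W" "x \<notin> W \<Longrightarrow> F x = 0" "F (\<tau> x) = F x"
  using assms by (auto simp: inv_hol_iff)

lemma inv_hol_add: "F \<in> inv_hol \<Longrightarrow> G \<in> inv_hol \<Longrightarrow> F + G \<in> inv_hol"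
  by (auto simp: inv_hol_iff plus_fun_def intro: hol_on_add)

lemma inv_hol_scale: "F \<in> inv_hol \<Longrightarrow> (\<lambda>x. c * F x) \<in> inv_hol"
  by (auto simp: inv_hol_iff intro: hol_on_mult)

text \<open>A class of elements that contains the universal ring and on which everything can be computed
  pointwise on \<open>Wg\<close>.\<close>

definition tame :: "'n skew \<Rightarrow> bool" where
  "tame A \<longleftrightarrow> finite (supp A) \<and> supp A \<subseteq> shifts \<and> (\<forall>m. A m \<in> mero W \<and> hol_on (A m) Wg)"

lemma tame_carrier: "tame A \<Longrightarrow> A \<in> carrier (skew_ring W)"
  by (auto simp: tame_def skew_ring_def)

lemma not_supp: "m \<notin> supp A \<Longrightarrow> A m x = 0"
  by (simp add: supp_def)

lemma reg_zero: "reg W (\<lambda>x. 0) = (\<lambda>x. 0)"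
  by (rule reg_eq_hol[OF open_W Wg_dense]) auto

lemma sum_supp:
  assumes "finite M" "supp A \<subseteq> M"
  shows "(\<Sum>m\<in>supp A. A m x * f m) = (\<Sum>m\<in>M. A m x * f m)"
  by (rule sum.mono_neutral_left[OF assms]) (auto simp: not_supp)

lemma hol_on_act_sum:
  assumes "\<And>m. m \<in> M \<Longrightarrow> hol_on (c m) U" "M \<subseteq> shifts" "hol_on F W" "U \<subseteq> W"
  shows "hol_on (\<lambda>x. \<Sum>m\<in>M. c m x * F (shift (- m) x)) U"
  using assms by (intro hol_on_sum hol_on_mult hol_on_shift[OF assms(3)]) (auto intro!: shift_W)

lemma act_Wg:
  assumes A: "tame A" and F: "F \<in> inv_hol" and x: "x \<in> Wg" and M: "finite M" "supp A \<subseteq> M"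
  shows "act W A F x = (\<Sum>m\<in>M. A m x * F (shift (- m) x))"
proof -
  have "hol_on (\<lambda>x. \<Sum>m\<in>supp A. A m x * F (shift (- m) x)) Wg"
    using A open_Wg inv_holD(1)[OF F] by (intro hol_on_act_sum) (auto simp: tame_def)
  from reg_hol[OF open_Wg(1) this open_Wg(2) x] show ?thesis
    by (simp add: act_def sum_supp[OF M])
qed

text \<open>An invariant holomorphic function is its own normal form, so it can be recognised on a dense set.\<close>

lemma act_eqI:
  assumes "tame A" "F \<in> inv_hol" "G \<in> inv_hol"
    and "\<And>x. x \<in> Wg \<Longrightarrow> (\<Sum>m\<in>supp A. A m x * F (shift (- m) x)) = G x"
  shows "act W A F = G"
  unfolding act_def
  by (rule reg_eq_hol[OF open_W Wg_dense assms(4)]) (auto simp: inv_holD[OF assms(3)])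

definition preserving :: "'n skew \<Rightarrow> bool" where
  "preserving A \<longleftrightarrow> tame A \<and> (\<forall>F\<in>inv_hol. act W A F \<in> inv_hol)"

lemma skew_ring_simps:
  "one (skew_ring W) = skew_const W 1"
  "zero (skew_ring W) = 0"
  "add (skew_ring W) A B l = reg W (\<lambda>x. A l x + B l x)"
  "monoid.mult (skew_ring W) A B l = reg W (\<lambda>x. \<Sum>m\<in>supp A. A m x * B (l - m) (shift (- m) x))"
  by (simp_all add: skew_ring_def plus_fun_def)

text \<open>All operations of the ring produce coefficients of the form \<open>reg W f\<close>, where \<open>f\<close> is given by a formula
  that is holomorphic on \<open>Wg\<close>.\<close>

lemma tameI:
  assumes "finite M" "M \<subseteq> shifts" "\<And>m. A m = reg W (f m)" "\<And>m. mero_on (f m) W"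
    "\<And>m. hol_on (f m) Wg" "\<And>m x. m \<notin> M \<Longrightarrow> f m x = 0"
  shows "tame A" "supp A \<subseteq> M" "x \<in> Wg \<Longrightarrow> A m x = f m x"
proof -
  have "A m = 0" if "m \<notin> M" for m
  proof -
    have "f m = (\<lambda>x. 0)" using assms(6)[OF that] by (simp add: fun_eq_iff)
    then show ?thesis using assms(3)[of m] reg_zero by (simp add: zero_fun_def)
  qed
  then show s: "supp A \<subseteq> M" by (auto simp: supp_def)
  have "hol_on (A m) Wg" for m
    using hol_on_reg[OF open_Wg(1) assms(5) open_Wg(2), of m] by (simp add: assms(3))
  then show "tame A" unfolding tame_def
    using s assms(1,2) reg_in_mero[OF assms(4)] by (auto simp: assms(3) intro: finite_subset)
  show "x \<in> Wg \<Longrightarrow> A m x = f m x"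
    using reg_hol[OF open_Wg(1) assms(5) open_Wg(2)] by (simp add: assms(3))
qed

lemma tameD:
  assumes "tame A"
  shows "finite (supp A)" "supp A \<subseteq> shifts" "mero_on (A m) W" "reg W (A m) = A m" "hol_on (A m) Wg"
  using assms by (auto simp: tame_def mero_def)

lemma tame_one: "tame (skew_const W c)" and skew_const_supp: "supp (skew_const W c) \<subseteq> {0}"
proof -
  have h: "hol_on (\<lambda>x. if x \<in> W then c else 0) W"
    by (rule hol_on_cong_open[OF open_W _ hol_on_const[of c]]) simp
  have hm: "hol_on (skew_const W c m) W" for m
    using h by (cases "m = 0") (simp_all add: skew_const_def)
  have r: "skew_const W c m = reg W (skew_const W c m)" for m
    by (rule reg_eq_hol[OF open_W Wg_dense refl hm, symmetric]) (simp add: skew_const_def)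
  note t = tameI[of "{0}" "skew_const W c" "skew_const W c",
      OF _ _ r mero_on_hol[OF open_W hm] hol_on_subset[OF hm open_Wg(2)]]
  show "tame (skew_const W c)" "supp (skew_const W c) \<subseteq> {0}"
    by (rule t; simp add: skew_const_def)+
qed

lemma act_const:
  assumes F: "F \<in> inv_hol" shows "act W (skew_const W c) F = (\<lambda>x. c * F x)"
proof (rule act_eqI[OF tame_one F inv_hol_scale[OF F]])
  fix x assume "x \<in> Wg"
  then have "x \<in> W" using open_Wg by auto
  then show "(\<Sum>m\<in>supp (skew_const W c). skew_const W c m x * F (shift (- m) x)) = c * F x"
    by (simp add: sum_supp[OF _ skew_const_supp]) (simp add: skew_const_def)
qed

lemma tame_add:
  assumes A: "tame A" and B: "tame B"
  shows "tame (add (skew_ring W) A B)" "supp (add (skew_ring W) A B) \<subseteq> supp A \<union> supp B"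
    "x \<in> Wg \<Longrightarrow> add (skew_ring W) A B l x = A l x + B l x"
proof -
  note t = tameI[of "supp A \<union> supp B" "add (skew_ring W) A B" "\<lambda>l x. A l x + B l x"]
  show "tame (add (skew_ring W) A B)" "supp (add (skew_ring W) A B) \<subseteq> supp A \<union> supp B"
    "x \<in> Wg \<Longrightarrow> add (skew_ring W) A B l x = A l x + B l x"
    by (rule t; use tameD[OF A] tameD[OF B] in
        \<open>auto simp: skew_ring_simps not_supp intro: mero_on_add hol_on_add\<close>)+
qed

lemma act_add:
  assumes A: "preserving A" and B: "preserving B" and F: "F \<in> inv_hol"
  shows "act W (add (skew_ring W) A B) F = act W A F + act W B F"
proof (rule act_eqI)
  have t: "tame A" "tame B" and a: "act W A F \<in> inv_hol" "act W B F \<in> inv_hol"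
    using A B F by (auto simp: preserving_def)
  show "tame (add (skew_ring W) A B)" by (rule tame_add[OF t])
  show "F \<in> inv_hol" by fact
  show "act W A F + act W B F \<in> inv_hol" using a by (rule inv_hol_add)
  fix x assume x: "x \<in> Wg"
  have f: "finite (supp A \<union> supp B)" using tameD(1)[OF t(1)] tameD(1)[OF t(2)] by simp
  show "(\<Sum>m\<in>supp (add (skew_ring W) A B). add (skew_ring W) A B m x * F (shift (- m) x)) =
        (act W A F + act W B F) x"
    unfolding sum_supp[OF f tame_add(2)[OF t]] plus_fun_def
      act_Wg[OF t(1) F x f Un_upper1] act_Wg[OF t(2) F x f Un_upper2]
    by (simp add: tame_add(3)[OF t x] algebra_simps sum.distrib)
qed

lemma preserving_add:
  assumes "preserving A" "preserving B" shows "preserving (add (skew_ring W) A B)"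
  using assms act_add[OF assms] tame_add(1)[of A B] inv_hol_add by (auto simp: preserving_def)

lemma preserving_one: "preserving (skew_const W c)"
  by (simp add: preserving_def tame_one act_const inv_hol_scale)

lemma tame_minus:
  assumes A: "tame A" shows "tame (- A)" "supp (- A) = supp A"
proof -
  show s: "supp (- A) = supp A" by (auto simp: supp_def)
  have "(- A) m = (\<lambda>x. - A m x)" for m by (simp add: fun_eq_iff)
  moreover have "(\<lambda>x. - A m x) \<in> mero W" for m
  proof -
    have "reg W (\<lambda>x. A m x + reg W (\<lambda>x. - A m x) x) = 0"
    proof -
      have "reg W (\<lambda>x. A m x + reg W (\<lambda>x. - A m x) x) = reg W (\<lambda>x. 0)"
        by (rule reg_cong[OF Wg_dense])
          (simp add: reg_hol[OF open_Wg(1) hol_on_minus[OF tameD(5)[OF A]] open_Wg(2)])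
      then show ?thesis by (simp add: reg_zero zero_fun_def)
    qed
    moreover have r: "reg W (\<lambda>x. - A m x) \<in> mero W"
      by (rule reg_in_mero[OF mero_on_minus[OF open_W tameD(3)[OF A]]])
    ultimately have "reg W (\<lambda>x. - A m x) = (\<lambda>x. - A m x)"
      using A by (intro mero_add_inverse_unique[where W = W]) (auto simp: tame_def)
    then show ?thesis using r by simp
  qed
  moreover have "hol_on (\<lambda>x. - A m x) Wg" for m by (rule hol_on_minus[OF tameD(5)[OF A]])
  ultimately show "tame (- A)" using tameD(1,2)[OF A] unfolding tame_def s by simp
qed

text \<open>The skew group ring is not known to be a ring here, so the inverse is computed from its description as the
  unique element of the carrier that adds up to zero with \<open>A\<close>.\<close>

lemma a_inv_tame:
  assumes A: "tame A" shows "a_inv (skew_ring W) A = - A"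
proof -
  have ad: "add (skew_ring W) A B = 0 \<Longrightarrow> B = - A" if "B \<in> carrier (skew_ring W)" for B
  proof
    fix m assume 0: "add (skew_ring W) A B = 0"
    have "reg W (\<lambda>x. A m x + B m x) = 0" using fun_cong[OF 0, of m] by (simp add: skew_ring_simps)
    then show "B m = (- A) m"
      using mero_add_inverse_unique[of "A m" W "B m"] A that by (auto simp: tame_def skew_ring_def)
  qed
  have c: "- A \<in> carrier (skew_ring W)" using tame_carrier[OF tame_minus(1)[OF A]] .
  have z: "add (skew_ring W) A (- A) = 0" "add (skew_ring W) (- A) A = 0"
    by (simp_all add: fun_eq_iff skew_ring_simps reg_zero)
  have "(THE B. B \<in> carrier (skew_ring W) \<and> add (skew_ring W) A B = 0 \<and> add (skew_ring W) B A = 0) = - A"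
  proof (rule the_equality)
    show "- A \<in> carrier (skew_ring W) \<and> add (skew_ring W) A (- A) = 0 \<and> add (skew_ring W) (- A) A = 0"
      by (intro conjI c z)
    fix B assume "B \<in> carrier (skew_ring W) \<and> add (skew_ring W) A B = 0 \<and> add (skew_ring W) B A = 0"
    then show "B = - A" by (elim conjE) (rule ad)
  qed
  then show ?thesis by (simp only: a_inv_def m_inv_def monoid.simps partial_object.simps skew_ring_simps(2))
qed

lemma act_minus:
  assumes "preserving A" "F \<in> inv_hol" shows "act W (- A) F = (\<lambda>x. - 1 * act W A F x)"
proof (rule act_eqI[OF tame_minus(1) assms(2) inv_hol_scale])
  show t: "tame A" "act W A F \<in> inv_hol" using assms by (auto simp: preserving_def)
  fix x assume "x \<in> Wg"
  then show "(\<Sum>m\<in>supp (- A). (- A) m x * F (shift (- m) x)) = - 1 * act W A F x"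
    using t by (simp add: tame_minus act_Wg[OF t(1) assms(2) _ tameD(1)[OF t(1)] order_refl] sum_negf)
qed

lemma preserving_minus:
  assumes "preserving A" shows "preserving (- A)"
  unfolding preserving_def
  using assms act_minus[OF assms] tame_minus(1)[of A] inv_hol_scale[of _ "- 1"] by (simp add: preserving_def)

lemma tame_mult:
  assumes A: "tame A" and B: "tame B"
  defines "L \<equiv> (\<lambda>(m, k). m + k) ` (supp A \<times> supp B)"
  shows "tame (monoid.mult (skew_ring W) A B)" "supp (monoid.mult (skew_ring W) A B) \<subseteq> L"
    "x \<in> Wg \<Longrightarrow> monoid.mult (skew_ring W) A B l x = (\<Sum>m\<in>supp A. A m x * B (l - m) (shift (- m) x))"
proof -
  have fin: "finite L" using tameD(1)[OF A] tameD(1)[OF B] by (simp add: L_def)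
  have LS: "L \<subseteq> shifts"
    using tameD(2)[OF A] tameD(2)[OF B] by (auto simp: L_def intro!: shifts_closed(3))
  have hol: "hol_on (\<lambda>x. \<Sum>m\<in>supp A. A m x * B (l - m) (shift (- m) x)) Wg" for l
  proof (intro hol_on_sum hol_on_mult hol_on_shift[where U = Wg] tameD(5)[OF A] tameD(5)[OF B])
    fix m x assume "m \<in> supp A" and x: "x \<in> Wg"
    then have "- m \<in> shifts" using tameD(2)[OF A] by (intro shifts_closed(2)) auto
    then show "shift (- m) x \<in> Wg" using x by (rule shift_Wg)
  qed
  have mer: "mero_on (\<lambda>x. \<Sum>m\<in>supp A. A m x * B (l - m) (shift (- m) x)) W" for l
  proof (intro mero_on_sum mero_on_mult open_W tameD(3)[OF A])
    fix m assume "m \<in> supp A"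
    then have m: "- m \<in> shifts" using tameD(2)[OF A] by auto
    show "mero_on (\<lambda>x. B (l - m) (shift (- m) x)) W"
      unfolding shift_eq_plus
      by (rule mero_on_translate[OF tameD(3)[OF B] _ open_W]) (use shift_W[OF m] in \<open>simp add: shift_eq_plus\<close>)
  qed
  have zero: "(\<Sum>m\<in>supp A. A m x * B (l - m) (shift (- m) x)) = 0" if "l \<notin> L" for l x
  proof (rule sum.neutral, rule ballI)
    fix m assume m: "m \<in> supp A"
    have "l - m \<notin> supp B"
    proof
      assume "l - m \<in> supp B"
      then have "m + (l - m) \<in> L" using m unfolding L_def by (intro image_eqI[of _ _ "(m, l - m)"]) auto
      then show False using that by simp
    qed
    then show "A m x * B (l - m) (shift (- m) x) = 0" by (simp add: not_supp)
  qed
  note t = tameI[of L "monoid.mult (skew_ring W) A B" "\<lambda>l x. \<Sum>m\<in>supp A. A m x * B (l - m) (shift (- m) x)",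
      OF fin LS skew_ring_simps(4) mer hol zero]
  show "tame (monoid.mult (skew_ring W) A B)" "supp (monoid.mult (skew_ring W) A B) \<subseteq> L"
    "x \<in> Wg \<Longrightarrow> monoid.mult (skew_ring W) A B l x = (\<Sum>m\<in>supp A. A m x * B (l - m) (shift (- m) x))"
    by (rule t; simp)+
qed

text \<open>At a point of \<open>Wg\<close> both sides are the same double sum. The inner action has to be evaluated at shifted
  points, which again belong to \<open>Wg\<close>.\<close>

lemma act_mult:
  assumes A: "preserving A" and B: "preserving B" and F: "F \<in> inv_hol"
  shows "act W (monoid.mult (skew_ring W) A B) F = act W A (act W B F)"
proof (rule act_eqI)
  have t: "tame A" "tame B" and BF: "act W B F \<in> inv_hol"
    using A B F by (auto simp: preserving_def)
  show "act W A (act W B F) \<in> inv_hol" using A BF by (auto simp: preserving_def)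
  show "tame (monoid.mult (skew_ring W) A B)" by (rule tame_mult[OF t])
  show "F \<in> inv_hol" by fact
  fix x assume x: "x \<in> Wg"
  let ?L = "(\<lambda>(m, k). m + k) ` (supp A \<times> supp B)"
  have fL: "finite ?L" using tameD(1)[OF t(1)] tameD(1)[OF t(2)] by simp
  have inner: "(\<Sum>l\<in>?L. B (l - m) (shift (- m) x) * F (shift (- l) x)) = act W B F (shift (- m) x)"
    if m: "m \<in> supp A" for m
  proof -
    have "- m \<in> shifts" using m tameD(2)[OF t(1)] by auto
    then have xm: "shift (- m) x \<in> Wg" using x by (rule shift_Wg)
    have "(\<Sum>l\<in>?L. B (l - m) (shift (- m) x) * F (shift (- l) x)) =
        (\<Sum>l\<in>(+) m ` supp B. B (l - m) (shift (- m) x) * F (shift (- l) x))"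
    proof (rule sum.mono_neutral_right[OF fL])
      show "(+) m ` supp B \<subseteq> ?L" using m by force
      show "\<forall>l\<in>?L - (+) m ` supp B. B (l - m) (shift (- m) x) * F (shift (- l) x) = 0"
      proof
        fix l assume l: "l \<in> ?L - (+) m ` supp B"
        have "l - m \<notin> supp B"
        proof
          assume "l - m \<in> supp B"
          then have "m + (l - m) \<in> (+) m ` supp B" by (rule imageI)
          then show False using l by simp
        qed
        then show "B (l - m) (shift (- m) x) * F (shift (- l) x) = 0" by (simp add: not_supp)
      qed
    qed
    also have "\<dots> = (\<Sum>k\<in>supp B. B k (shift (- m) x) * F (shift (- k) (shift (- m) x)))"
      by (subst sum.reindex) (auto simp: inj_on_def shift_shift minus_diff_commute intro!: sum.cong)
    also have "\<dots> = act W B F (shift (- m) x)"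
      by (rule act_Wg[OF t(2) F xm tameD(1)[OF t(2)] order_refl, symmetric])
    finally show ?thesis .
  qed
  have "(\<Sum>l\<in>supp (monoid.mult (skew_ring W) A B). monoid.mult (skew_ring W) A B l x * F (shift (- l) x))
      = (\<Sum>l\<in>?L. (\<Sum>m\<in>supp A. A m x * B (l - m) (shift (- m) x)) * F (shift (- l) x))"
    by (subst sum_supp[OF fL tame_mult(2)[OF t]]) (simp only: tame_mult(3)[OF t x])
  also have "\<dots> = (\<Sum>m\<in>supp A. A m x * (\<Sum>l\<in>?L. B (l - m) (shift (- m) x) * F (shift (- l) x)))"
    unfolding sum_distrib_right sum_distrib_left
    by (subst sum.swap) (simp only: mult.assoc)
  also have "\<dots> = (\<Sum>m\<in>supp A. A m x * act W B F (shift (- m) x))"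
    by (rule sum.cong) (simp_all only: inner)
  also have "\<dots> = act W A (act W B F) x"
    by (rule act_Wg[OF t(1) BF x tameD(1)[OF t(1)] order_refl, symmetric])
  finally show "(\<Sum>m\<in>supp (monoid.mult (skew_ring W) A B). monoid.mult (skew_ring W) A B m x * F (shift (- m) x))
    = act W A (act W B F) x" .
qed

lemma preserving_mult:
  assumes "preserving A" "preserving B" shows "preserving (monoid.mult (skew_ring W) A B)"
  using assms act_mult[OF assms] tame_mult(1)[of A B] by (auto simp: preserving_def)

section \<open>The generators of the universal ring\<close>


text \<open>The numerators \<open>H\<close> are kept as data: on the hyperplane the action is expressed by their derivatives.\<close>

definition generator :: "'n skew \<Rightarrow> (('n pos \<Rightarrow> int) \<Rightarrow> 'n tableau \<Rightarrow> complex) \<Rightarrow> bool" where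
  "generator A H \<longleftrightarrow> A \<in> skew_invariants W v \<and>
     (\<forall>m. hol_on (H m) W \<and> A m = reg W (\<lambda>x. H m x / z x))"

definition derivation_e :: "('n tableau \<Rightarrow> complex) \<Rightarrow> 'n tableau \<Rightarrow> complex" where
  "derivation_e f x = frechet_derivative f (at x) e"

lemma hol_on_quotient_z:
  assumes "hol_on f W" shows "hol_on (\<lambda>x. f x / z x) W0"
  by (rule hol_on_divide[OF hol_on_subset[OF assms open_W0(2)] hol_on_z]) (simp add: W0_def)

lemma generator_value:
  assumes "generator A H" "x \<in> W0" shows "A m x = H m x / z x"
  using assms reg_hol[OF open_W0(1) hol_on_quotient_z open_W0(2) assms(2)]
  by (simp add: generator_def)

lemma generator_hol:
  assumes "generator A H" shows "hol_on (A m) W0"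
proof (rule hol_on_cong_open[OF open_W0(1)])
  show "hol_on (\<lambda>x. H m x / z x) W0"
    using assms by (intro hol_on_quotient_z) (simp add: generator_def)
qed (simp add: generator_value[OF assms])

lemma generator_tame:
  assumes "generator A H" shows "tame A"
proof -
  have "A \<in> carrier (skew_ring W)" using assms by (simp add: generator_def skew_invariants_def)
  then show ?thesis
    using hol_on_subset[OF generator_hol[OF assms] Wg_W0] by (auto simp: tame_def skew_ring_def)
qed

lemma generator_equivariant:
  assumes "generator A H" shows "A (reflect m) (\<tau> x) = A m x"
proof -
  have "perm_skew (swap p q) A = A" using assms by (simp add: generator_def skew_invariants_def stab)
  then have "perm_skew (swap p q) A m x = A m x" by simp
  then show ?thesis by (simp add: perm_skew_def inv_swap)
qed

lemma generator_supp_reflect: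
  assumes "generator A H" shows "bij_betw reflect (supp A) (supp A)"
proof (rule bij_betw_byWitness[where f' = reflect])
  have cs: "reflect m \<in> supp A" if m: "m \<in> supp A" for m
  proof -
    obtain x where x: "A m x \<noteq> 0" using m by (auto simp: supp_def fun_eq_iff)
    have "A (reflect m) \<noteq> 0"
    proof
      assume "A (reflect m) = 0"
      then have "A (reflect m) (\<tau> x) = 0" by simp
      then show False using x generator_equivariant[OF assms, of m x] by simp
    qed
    then show ?thesis by (simp add: supp_def)
  qed
  show "reflect ` supp A \<subseteq> supp A" "reflect ` supp A \<subseteq> supp A" by (rule image_subsetI, erule cs)+
qed auto

lemma generator_sum_swap:
  assumes A: "generator A H" and F: "F \<in> inv_hol"
  shows "(\<Sum>m\<in>supp A. A m (\<tau> x) * F (shift (- m) (\<tau> x))) = (\<Sum>m\<in>supp A. A m x * F (shift (- m) x))"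
proof -
  have "(\<Sum>m\<in>supp A. A m (\<tau> x) * F (shift (- m) (\<tau> x))) =
      (\<Sum>m\<in>supp A. A (reflect m) (\<tau> x) * F (shift (- reflect m) (\<tau> x)))"
    by (rule sum.reindex_bij_betw[OF generator_supp_reflect[OF A], symmetric])
  also have "\<dots> = (\<Sum>m\<in>supp A. A m x * F (shift (- m) x))"
    by (simp add: generator_equivariant[OF A] reflect_minus[symmetric] shift_reflect inv_holD(3)[OF F])
  finally show ?thesis .
qed

text \<open>Invariance of \<open>A\<close> and \<open>F\<close> makes \<open>S\<close> odd under the transposition, first where \<open>z \<noteq> 0\<close> and then
  everywhere by density. An odd function vanishes at fixed points, that is on \<open>z = 0\<close>, so it can be divided by \<open>z\<close>.\<close>

lemma generator_act:
  assumes A: "generator A H" and F: "F \<in> inv_hol"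
  defines "S \<equiv> \<lambda>x. \<Sum>m\<in>supp A. H m x * F (shift (- m) x)"
  shows "act W A F \<in> inv_hol"
    and "x \<in> W0 \<Longrightarrow> act W A F x = (\<Sum>m\<in>supp A. A m x * F (shift (- m) x))"
    and "x \<in> W \<Longrightarrow> z x = 0 \<Longrightarrow> act W A F x = derivation_e S x"
proof -
  note t = tameD[OF generator_tame[OF A]]
  have S: "hol_on S W"
    unfolding S_def
    by (rule hol_on_act_sum[OF _ t(2) inv_holD(1)[OF F] order_refl]) (use A in \<open>simp add: generator_def\<close>)
  have Sz: "S x = z x * (\<Sum>m\<in>supp A. A m x * F (shift (- m) x))" if "x \<in> W0" for x
    using that by (simp add: S_def generator_value[OF A] sum_distrib_left W0_def)
  have W0_swap: "\<tau> x \<in> W0 \<longleftrightarrow> x \<in> W0" for x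
    by (simp add: W0_def swap_W_iff z_swap)
  have anti: "S (\<tau> x) = - S x" if "x \<in> W" for x
  proof (rule hol_eq_on_dense[OF hol_on_swap(1)[OF S] hol_on_minus[OF S] W0_dense _ that])
    fix x assume "x \<in> W0"
    then show "S (\<tau> x) = - S x"
      using Sz[of x] Sz[of "\<tau> x"] W0_swap generator_sum_swap[OF A F, of x] by (simp add: z_swap)
  qed
  have zero: "S x = 0" if "x \<in> W" "z x = 0" for x
    using anti[OF that(1)] swap_fixed[OF that(2)] by simp
  obtain G where G: "hol_on G W" "\<And>x. x \<in> W \<Longrightarrow> S x = z x * G x"
    "\<And>x. x \<in> W \<Longrightarrow> z x = 0 \<Longrightarrow> G x = frechet_derivative S (at x) e"
    using hyperplane_division[OF z_linear z_scale z_e open_W S zero] by metis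
  define G' where "G' x = (if x \<in> W then G x else 0)" for x
  have G': "hol_on G' W"
    by (rule hol_on_cong_open[OF open_W _ G(1)]) (simp add: G'_def)
  have GW0: "G' x = (\<Sum>m\<in>supp A. A m x * F (shift (- m) x))" if "x \<in> W0" for x
    using Sz[OF that] G(2)[of x] that by (simp add: G'_def W0_def)
  have act: "act W A F = G'"
    unfolding act_def
    by (rule reg_eq_hol[OF open_W W0_dense _ G']) (rule GW0[symmetric], assumption, simp add: G'_def)
  have "G' (\<tau> x) = G' x" for x
  proof (cases "x \<in> W")
    case True
    show ?thesis
    proof (rule hol_eq_on_dense[OF hol_on_swap(1)[OF G'] G' W0_dense _ True])
      fix x assume "x \<in> W0"
      then show "G' (\<tau> x) = G' x" using GW0 W0_swap generator_sum_swap[OF A F, of x] by simp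
    qed
  next
    case False then show ?thesis by (simp add: G'_def swap_W_iff)
  qed
  then show "act W A F \<in> inv_hol"
    using G' by (simp add: act inv_hol_iff) (simp add: G'_def)
  show "x \<in> W0 \<Longrightarrow> act W A F x = (\<Sum>m\<in>supp A. A m x * F (shift (- m) x))"
    by (simp add: act GW0)
  show "x \<in> W \<Longrightarrow> z x = 0 \<Longrightarrow> act W A F x = derivation_e S x"
    by (simp add: act G'_def G(3) derivation_e_def)
qed

lemma generator_preserving: "generator A H \<Longrightarrow> preserving A"
  by (simp add: preserving_def generator_tame generator_act(1))

lemma derivation_cong:
  assumes "open U" "x \<in> U" "hol_on f U" "\<And>y. y \<in> U \<Longrightarrow> f y = g y"
  shows "derivation_e g x = derivation_e f x"
proof -
  have "(g has_derivative frechet_derivative f (at x)) (at x)"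
    by (rule has_derivative_transform_within_open[OF hol_onD(1)[OF assms(3,2)] assms(1,2,4)])
  from frechet_derivative_at[OF this] show ?thesis by (simp add: derivation_e_def)
qed

lemma derivation_mult:
  assumes "hol_on f U" "hol_on g U" "x \<in> U"
  shows "derivation_e (\<lambda>x. f x * g x) x = derivation_e f x * g x + f x * derivation_e g x"
  using frechet_derivative_at[OF has_derivative_mult[OF hol_onD(1)[OF assms(1,3)] hol_onD(1)[OF assms(2,3)]], symmetric]
  by (simp add: derivation_e_def add.commute)

lemma derivation_sum:
  assumes "\<And>i. i \<in> I \<Longrightarrow> hol_on (f i) U" "x \<in> U"
  shows "derivation_e (\<lambda>x. \<Sum>i\<in>I. f i x) x = (\<Sum>i\<in>I. derivation_e (f i) x)"
proof -
  have "((\<lambda>x. \<Sum>i\<in>I. f i x) has_derivative (\<lambda>h. \<Sum>i\<in>I. frechet_derivative (f i) (at x) h)) (at x)"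
    by (rule has_derivative_sum) (rule hol_onD(1)[OF assms(1) assms(2)])
  from frechet_derivative_at[OF this, symmetric] show ?thesis by (simp add: derivation_e_def)
qed

lemma derivation_shift:
  assumes "hol_on F W" "m \<in> shifts" "x \<in> W"
  shows "derivation_e (\<lambda>x. F (shift m x)) x = derivation_e F (shift m x)"
  unfolding derivation_e_def by (rule frechet_derivative_shift[OF assms(1) shift_W[OF assms(2,3)]])

lemma derivation_act_sum:
  assumes c: "\<And>m. m \<in> M \<Longrightarrow> hol_on (c m) U" and M: "M \<subseteq> shifts" and F: "hol_on F W"
    and U: "U \<subseteq> W" "x \<in> U"
  shows "derivation_e (\<lambda>x. \<Sum>m\<in>M. c m x * F (shift (- m) x)) x =
    (\<Sum>m\<in>M. derivation_e (c m) x * F (shift (- m) x) + c m x * derivation_e F (shift (- m) x))"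
proof -
  have Fm: "hol_on (\<lambda>x. F (shift (- m) x)) U" if "m \<in> M" for m
  proof (rule hol_on_shift[OF F])
    fix x assume "x \<in> U"
    then show "shift (- m) x \<in> W" using that M U(1) by (intro shift_W shifts_closed(2)) auto
  qed
  have "derivation_e (\<lambda>x. \<Sum>m\<in>M. c m x * F (shift (- m) x)) x =
      (\<Sum>m\<in>M. derivation_e (\<lambda>x. c m x * F (shift (- m) x)) x)"
    by (rule derivation_sum[OF hol_on_mult[OF c Fm] U(2)])
  also have "\<dots> = (\<Sum>m\<in>M. derivation_e (c m) x * F (shift (- m) x) + c m x * derivation_e F (shift (- m) x))"
  proof (rule sum.cong[OF refl])
    fix m assume m: "m \<in> M"
    have "- m \<in> shifts" using m M by (intro shifts_closed(2)) auto
    then have "derivation_e (\<lambda>x. F (shift (- m) x)) x = derivation_e F (shift (- m) x)"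
      using U by (intro derivation_shift[OF F]) auto
    then show "derivation_e (\<lambda>x. c m x * F (shift (- m) x)) x =
      derivation_e (c m) x * F (shift (- m) x) + c m x * derivation_e F (shift (- m) x)"
      by (simp add: derivation_mult[OF c[OF m] Fm[OF m] U(2)])
  qed
  finally show ?thesis .
qed

text \<open>The transposition reverses the direction \<open>e\<close>.\<close>

lemma derivation_swap:
  assumes F: "F \<in> inv_hol" and x: "x \<in> W"
  shows "derivation_e F (\<tau> x) = - derivation_e F x"
proof -
  have "(\<lambda>x. F (\<tau> x)) = F" using inv_holD(3)[OF F] by simp
  then have "derivation_e F x = frechet_derivative F (at (\<tau> x)) (\<tau> e)"
    using hol_on_swap(2)[OF inv_holD(1)[OF F] x, of e] by (simp add: derivation_e_def)
  moreover have "linear (frechet_derivative F (at (\<tau> x)))"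
    using hol_onD(1)[OF inv_holD(1)[OF F] swap_W[OF x]] by (rule has_derivative_linear)
  ultimately show ?thesis by (simp add: swap_e linear_neg derivation_e_def)
qed

text \<open>On the hyperplane the two sides of \<open>derivation_swap\<close> belong to the same point.\<close>

lemma derivation_on_hyperplane:
  assumes "F \<in> inv_hol" "x \<in> W" "z x = 0" shows "derivation_e F x = 0"
  using derivation_swap[OF assms(1,2)] swap_fixed[OF assms(3)] by simp

end

section \<open>The space of local distributions\<close>

interpretation functional: vector_space scale_functional
  by unfold_locales (auto simp: scale_functional_def fun_eq_iff algebra_simps)

lemma sum_functional_apply: "(\<Sum>i\<in>I. D i) F = (\<Sum>i\<in>I. D i F :: complex)"
  by (induction I rule: infinite_finite_induct) auto

context singular_point
begin

definition evaluation :: "('n pos \<Rightarrow> int) \<Rightarrow> 'n functional" where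
  "evaluation m F = (if F \<in> inv_hol then F (shift (- m) v) else 0)"

definition derivative :: "('n pos \<Rightarrow> int) \<Rightarrow> 'n functional" where
  "derivative m F = (if F \<in> inv_hol then derivation_e F (shift (- m) v) else 0)"

abbreviation dist_space :: "'n functional set" where
  "dist_space \<equiv> distribution_space p q v W"

lemma derivation_const: "derivation_e (\<lambda>x. c) x = 0"
  using frechet_derivative_at[OF has_derivative_const[of c "at x"], symmetric]
  by (simp add: derivation_e_def)

lemma shift_point_W: "m \<in> shifts \<Longrightarrow> shift (- m) v \<in> W"
  by (intro shift_W shifts_closed(2) v_W)

lemma swap_v: "\<tau> v = v"
  by (rule swap_fixed[OF v_zero])

lemma shift_reflect_v: "shift (- reflect m) v = \<tau> (shift (- m) v)"
  using shift_reflect[of "- m" v] by (simp add: swap_v reflect_minus)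

text \<open>The two shifts carry \<open>v\<close> to points that the transposition interchanges, where \<open>F\<close> has the same value; the factor
  \<open>1 / 2\<close> accounts for the two terms.\<close>

lemma D1_eq_evaluation:
  assumes m: "m \<in> shifts" shows "D1 p q v W m = evaluation m"
proof
  fix F
  define B where "B = (monomial 1 m + monomial 1 (reflect m) :: 'n skew)"
  show "D1 p q v W m F = evaluation m F"
  proof (cases "F \<in> inv_hol")
    case F: True
    have s: "supp B \<subseteq> {m, reflect m}" by (auto simp: B_def supp_def monomial_def)
    have raw: "(\<Sum>l\<in>supp B. B l x * F (shift (- l) x)) = F (shift (- m) x) + F (shift (- reflect m) x)" for x
    proof -
      have "(\<Sum>l\<in>supp B. B l x * F (shift (- l) x)) = (\<Sum>l\<in>{m, reflect m}. B l x * F (shift (- l) x))"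
        by (rule sum_supp[OF _ s]) simp
      also have "\<dots> = F (shift (- m) x) + F (shift (- reflect m) x)"
        by (cases "reflect m = m") (auto simp: B_def monomial_def)
      finally show ?thesis .
    qed
    have "hol_on (\<lambda>x. F (shift (- m) x) + F (shift (- reflect m) x)) W"
      using m by (intro hol_on_add hol_on_shift[OF inv_holD(1)[OF F]]) (auto intro!: shift_W shifts_closed(2))
    then have "act W B F v = F (shift (- m) v) + F (shift (- reflect m) v)"
      unfolding act_def raw by (rule reg_hol[OF open_W _ order_refl v_W])
    then show ?thesis using F
      by (simp add: D1_def scale_functional_def comp_act_def evaluation_def B_def shift_reflect_v inv_holD(3))
  next
    case False
    then show ?thesis by (simp add: D1_def scale_functional_def comp_act_def evaluation_def)
  qed
qed

text \<open>The numerator \<open>S\<close> vanishes on the hyperplane, so the value of the quotient at \<open>v\<close> is the derivative of \<open>S\<close> in direction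
  \<open>e\<close>. Its two terms contribute equally, as \<open>F\<close> is even and \<open>e\<close> is odd under the transposition.\<close>

lemma D2_eq_derivative:
  assumes m: "m \<in> shifts" and ne: "reflect m \<noteq> m" shows "D2 p q v W m = derivative m"
proof
  fix F
  define f where "f = (\<lambda>x. 1 / (2 * z x))"
  define B where "B = (monomial f m - monomial f (reflect m) :: 'n skew)"
  show "D2 p q v W m F = derivative m F"
  proof (cases "F \<in> inv_hol")
    case F: True
    define c where "c l = (if l = m then 1 / 2 else - 1 / 2 :: complex)" for l
    define S where "S x = (\<Sum>l\<in>{m, reflect m}. c l * F (shift (- l) x))" for x
    have M: "{m, reflect m} \<subseteq> shifts" using m by simp
    have s: "supp B \<subseteq> {m, reflect m}" by (auto simp: B_def supp_def monomial_def)
    have raw: "(\<Sum>l\<in>supp B. B l x * F (shift (- l) x)) = S x / z x" for x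
    proof -
      have "(\<Sum>l\<in>supp B. B l x * F (shift (- l) x)) = (\<Sum>l\<in>{m, reflect m}. B l x * F (shift (- l) x))"
        by (rule sum_supp[OF _ s]) simp
      also have "\<dots> = (\<Sum>l\<in>{m, reflect m}. c l * F (shift (- l) x) / z x)"
        using ne by (intro sum.cong) (auto simp: B_def monomial_def f_def c_def)
      finally show ?thesis by (simp only: S_def sum_divide_distrib)
    qed
    have S: "hol_on S W"
      unfolding S_def by (rule hol_on_act_sum[OF hol_on_const M inv_holD(1)[OF F] order_refl])
    have zero: "S x = 0" if "x \<in> W" "z x = 0" for x
    proof -
      have "shift (- reflect m) x = \<tau> (shift (- m) x)"
        using shift_reflect[of "- m" x] swap_fixed[OF that(2)] by (simp add: reflect_minus)
      then show ?thesis using ne by (simp add: S_def c_def inv_holD(3)[OF F])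
    qed
    obtain G where G: "hol_on G W" "\<And>x. x \<in> W \<Longrightarrow> S x = z x * G x"
      "\<And>x. x \<in> W \<Longrightarrow> z x = 0 \<Longrightarrow> G x = frechet_derivative S (at x) e"
      using hyperplane_division[OF z_linear z_scale z_e open_W S zero] by metis
    have "act W B F v = G v"
      unfolding act_def raw
      by (rule reg_eqI[OF open_W v_W order_refl G(1) W0_dense]) (use G(2) in \<open>simp add: W0_def\<close>)
    also have "\<dots> = derivation_e S v"
      using G(3)[OF v_W v_zero] by (simp add: derivation_e_def)
    also have "\<dots> = (\<Sum>l\<in>{m, reflect m}. c l * derivation_e F (shift (- l) v))"
      unfolding S_def
      using derivation_act_sum[OF hol_on_const M inv_holD(1)[OF F] order_refl v_W, of c]
      by (simp add: derivation_const)
    also have "\<dots> = derivation_e F (shift (- m) v)"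
      using ne derivation_swap[OF F shift_point_W[OF m]] by (simp add: c_def shift_reflect_v)
    finally show ?thesis using F by (simp add: D2_def comp_act_def derivative_def B_def f_def)
  next
    case False then show ?thesis by (simp add: D2_def comp_act_def derivative_def)
  qed
qed

lemma evaluation_reflect: "evaluation (reflect m) = evaluation m"
  by (simp add: evaluation_def fun_eq_iff shift_reflect_v inv_holD(3))

lemma derivative_reflect:
  assumes "m \<in> shifts" shows "derivative (reflect m) = scale_functional (- 1) (derivative m)"
  using derivation_swap[OF _ shift_point_W[OF assms]]
  by (simp add: derivative_def fun_eq_iff shift_reflect_v scale_functional_def)

lemma derivative_fixed:
  assumes "m \<in> shifts" "reflect m = m" shows "derivative m = 0"
proof
  fix F
  have "z (shift (- m) v) = 0" using assms(2) v_zero by (simp add: z_shift reflect_eq_iff)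
  then show "derivative m F = 0 F"
    using derivation_on_hyperplane[OF _ shift_point_W[OF assms(1)]] by (simp add: derivative_def)
qed

lemma half_shifts_cases:
  assumes "m \<in> shifts" shows "m \<in> half_shifts p q \<or> reflect m \<in> half_shifts p q"
proof -
  have "reflect m p = m q" "reflect m q = m p" by (simp_all add: perm_shift_def)
  then show ?thesis using assms by (auto simp: half_shifts_def)
qed

text \<open>Either a shift or its reflection lies in \<open>half_shifts\<close>, and both give the same evaluation.\<close>

lemma evaluation_in_space:
  assumes m: "m \<in> shifts" shows "evaluation m \<in> dist_space"
proof -
  have "evaluation l \<in> dist_space" if "l \<in> half_shifts p q" for l
  proof -
    have "D1 p q v W l \<in> local_distributions p q v W"
      using that by (auto simp: local_distributions_def)
    then show ?thesis
      using that D1_eq_evaluation[of l]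
      by (auto simp: distribution_space_def half_shifts_def intro: functional.span_base)
  qed
  then show ?thesis using half_shifts_cases[OF m] evaluation_reflect[of m] by metis
qed

text \<open>As for evaluations, up to a sign; a shift fixed by the reflection gives the zero functional.\<close>

lemma derivative_in_space:
  assumes m: "m \<in> shifts" shows "derivative m \<in> dist_space"
proof (cases "reflect m = m")
  case True
  then show ?thesis
    using derivative_fixed[OF m] by (simp add: distribution_space_def functional.span_zero)
next
  case ne: False
  have D: "derivative l \<in> dist_space" if "l \<in> half_shifts p q" "reflect l \<noteq> l" for l
  proof -
    have "D2 p q v W l \<in> local_distributions p q v W"
      using that by (auto simp: local_distributions_def)
    then show ?thesis
      using that D2_eq_derivative[of l]
      by (auto simp: distribution_space_def half_shifts_def intro: functional.span_base)
  qed
  have "reflect (reflect m) \<noteq> reflect m" using ne by (metis reflect_reflect)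
  moreover have "derivative m = scale_functional (- 1) (derivative (reflect m))"
    using derivative_reflect[of "reflect m"] m by simp
  ultimately show ?thesis
    using half_shifts_cases[OF m] D[of m] D[of "reflect m"] ne
    by (metis distribution_space_def functional.span_scale)
qed

lemma local_distributions_cases:
  assumes "D \<in> local_distributions p q v W"
  obtains m where "m \<in> shifts" "D = evaluation m" | m where "m \<in> shifts" "D = derivative m"
  using assms D1_eq_evaluation D2_eq_derivative
  by (auto simp: local_distributions_def half_shifts_def)

lemma dist_space_subspace: "functional.subspace dist_space"
  by (simp add: distribution_space_def)

lemma dist_space_induct:
  assumes D: "D \<in> dist_space" and sub: "functional.subspace {D. P D}"
    and "\<And>m. m \<in> shifts \<Longrightarrow> P (evaluation m)" "\<And>m. m \<in> shifts \<Longrightarrow> P (derivative m)"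
  shows "P D"
proof -
  have "P E" if "E \<in> local_distributions p q v W" for E
    using local_distributions_cases[OF that] assms(3,4) by metis
  then show ?thesis
    using functional.span_induct[OF D[unfolded distribution_space_def] sub] by blast
qed

text \<open>Functionals must be additive on invariant functions for composition with operators to be additive
  in the operator. Every distribution in the span has this property.\<close>

definition linear_on_inv :: "'n functional \<Rightarrow> bool" where
  "linear_on_inv D \<longleftrightarrow> (\<forall>F. F \<notin> inv_hol \<longrightarrow> D F = 0) \<and>
     (\<forall>F\<in>inv_hol. \<forall>G\<in>inv_hol. D (F + G) = D F + D G) \<and>
     (\<forall>c. \<forall>F\<in>inv_hol. D (\<lambda>x. c * F x) = c * D F)"

lemma derivation_add:
  assumes "hol_on f U" "hol_on g U" "x \<in> U"
  shows "derivation_e (f + g) x = derivation_e f x + derivation_e g x"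
  using frechet_derivative_at[OF has_derivative_add[OF hol_onD(1)[OF assms(1,3)] hol_onD(1)[OF assms(2,3)]], symmetric]
  by (simp add: derivation_e_def plus_fun_def)

lemma dist_space_linear:
  assumes "D \<in> dist_space" shows "linear_on_inv D"
proof (rule dist_space_induct[OF assms])
  show "functional.subspace {D. linear_on_inv D}"
    by (rule functional.subspaceI)
      (auto simp: linear_on_inv_def scale_functional_def algebra_simps)
  fix m :: "'n pos \<Rightarrow> int" assume m: "m \<in> shifts"
  show "linear_on_inv (evaluation m)"
    by (simp add: linear_on_inv_def evaluation_def inv_hol_add inv_hol_scale)
  show "linear_on_inv (derivative m)"
    using derivation_add[OF _ _ shift_point_W[OF m]] shift_point_W[OF m]
      derivation_mult[OF hol_on_const _ shift_point_W[OF m]]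
    by (simp add: linear_on_inv_def derivative_def inv_hol_add inv_hol_scale inv_holD(1) derivation_const)
qed

lemma comp_act_apply: "F \<in> inv_hol \<Longrightarrow> comp_act W v D A F = D (act W A F)"
  by (simp add: comp_act_def)

lemma comp_act_outside: "F \<notin> inv_hol \<Longrightarrow> comp_act W v D A F = 0"
  by (simp add: comp_act_def)

lemma comp_act_left_add: "comp_act W v (D + E) A = comp_act W v D A + comp_act W v E A"
  by (simp add: comp_act_def fun_eq_iff)

lemma comp_act_left_scale: "comp_act W v (scale_functional c D) A = scale_functional c (comp_act W v D A)"
  by (simp add: comp_act_def fun_eq_iff scale_functional_def)

lemma comp_act_ring_add:
  assumes "linear_on_inv D" "preserving A" "preserving B"
  shows "comp_act W v D (add (skew_ring W) A B) = comp_act W v D A + comp_act W v D B"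
proof
  fix F
  show "comp_act W v D (add (skew_ring W) A B) F = (comp_act W v D A + comp_act W v D B) F"
  proof (cases "F \<in> inv_hol")
    case True
    then have "act W A F \<in> inv_hol" "act W B F \<in> inv_hol"
      using assms(2,3) by (simp_all add: preserving_def)
    then have "D (act W A F + act W B F) = D (act W A F) + D (act W B F)"
      using assms(1) unfolding linear_on_inv_def by blast
    then show ?thesis
      by (simp only: comp_act_apply[OF True] act_add[OF assms(2,3) True] plus_fun_apply)
  next
    case False then show ?thesis by (simp add: comp_act_outside)
  qed
qed

lemma comp_act_ring_mult:
  assumes "preserving A" "preserving B"
  shows "comp_act W v D (monoid.mult (skew_ring W) A B) = comp_act W v (comp_act W v D A) B"
proof
  fix F
  show "comp_act W v D (monoid.mult (skew_ring W) A B) F = comp_act W v (comp_act W v D A) B F"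
  proof (cases "F \<in> inv_hol")
    case True
    then have "act W B F \<in> inv_hol" using assms(2) by (simp add: preserving_def)
    then show ?thesis by (simp only: comp_act_apply True act_mult[OF assms True])
  next
    case False then show ?thesis by (simp add: comp_act_outside)
  qed
qed

lemma comp_act_const:
  assumes "linear_on_inv D" shows "comp_act W v D (skew_const W c) = scale_functional c D"
  using assms by (simp add: comp_act_def fun_eq_iff linear_on_inv_def scale_functional_def act_const)

lemma comp_act_minus:
  assumes "linear_on_inv D" "preserving A"
  shows "comp_act W v D (- A) = scale_functional (- 1) (comp_act W v D A)"
proof
  fix F
  show "comp_act W v D (- A) F = scale_functional (- 1) (comp_act W v D A) F"
  proof (cases "F \<in> inv_hol")
    case True
    then have "act W A F \<in> inv_hol" using assms(2) by (simp add: preserving_def)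
    then have "D (\<lambda>x. - 1 * act W A F x) = - 1 * D (act W A F)"
      using assms(1) unfolding linear_on_inv_def by blast
    then show ?thesis
      by (simp only: comp_act_apply[OF True] act_minus[OF assms(2) True] scale_functional_def)
  next
    case False then show ?thesis by (simp add: comp_act_outside scale_functional_def)
  qed
qed

definition stable :: "'n skew \<Rightarrow> bool" where
  "stable A \<longleftrightarrow> preserving A \<and> (\<forall>D\<in>dist_space. comp_act W v D A \<in> dist_space)"

text \<open>The shape in which the Leibniz rule delivers the composed functionals. What matters is that the
  coefficients \<open>a\<close> and \<open>b\<close> do not depend on \<open>F\<close>.\<close>

lemma combination_in_space:
  assumes M: "M \<subseteq> shifts" and out: "\<And>F. F \<notin> inv_hol \<Longrightarrow> D F = 0"
    and val: "\<And>F. F \<in> inv_hol \<Longrightarrow> D F =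
      (\<Sum>m\<in>M. a m * F (shift (- m) w) + b m * derivation_e F (shift (- m) w))"
    and w: "w = shift (- s) v" and s: "s \<in> shifts"
  shows "D \<in> dist_space"
proof -
  have "D = (\<Sum>m\<in>M. scale_functional (a m) (evaluation (m + s)) + scale_functional (b m) (derivative (m + s)))"
  proof
    fix F
    have "shift (- m) w = shift (- (m + s)) v" for m by (simp add: w shift_shift)
    then show "D F = (\<Sum>m\<in>M. scale_functional (a m) (evaluation (m + s)) + scale_functional (b m) (derivative (m + s))) F"
      by (cases "F \<in> inv_hol")
        (simp_all add: sum_functional_apply scale_functional_def evaluation_def derivative_def val out)
  qed
  moreover have "evaluation (m + s) \<in> dist_space" "derivative (m + s) \<in> dist_space" if "m \<in> M" for m
  proof -
    have "m + s \<in> shifts" using that M s by (intro shifts_closed(3)) auto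
    then show "evaluation (m + s) \<in> dist_space" "derivative (m + s) \<in> dist_space"
      by (rule evaluation_in_space derivative_in_space)+
  qed
  ultimately show ?thesis
    by (simp only:) (intro functional.subspace_sum functional.subspace_add functional.subspace_scale dist_space_subspace)
qed

text \<open>At a point \<open>w\<close> of the orbit off the hyperplane, the coefficients of \<open>A\<close> are holomorphic and the Leibniz rule
  for \<open>A F\<close> suffices. On the hyperplane, the value of \<open>A F\<close> is the derivative of the sum with the numerators
  \<open>H\<close> as coefficients, and the derivative of \<open>A F\<close> vanishes.\<close>

lemma generator_stable:
  assumes A: "generator A H" shows "stable A"
proof -
  note pres = generator_preserving[OF A] and t = tameD[OF generator_tame[OF A]]
  have H: "hol_on (H m) W" for m using A by (simp add: generator_def)
  have ev: "comp_act W v (evaluation s) A \<in> dist_space" if s: "s \<in> shifts" for s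
  proof -
    define w where "w = shift (- s) v"
    have w: "w \<in> W" using shift_point_W[OF s] by (simp add: w_def)
    have val: "comp_act W v (evaluation s) A F = act W A F w" if F: "F \<in> inv_hol" for F
      using pres F by (simp add: comp_act_apply evaluation_def preserving_def w_def)
    show ?thesis
    proof (cases "z w = 0")
      case True
      show ?thesis
      proof (rule combination_in_space[OF t(2) comp_act_outside _ w_def s])
        fix F assume F: "F \<in> inv_hol"
        show "comp_act W v (evaluation s) A F = (\<Sum>m\<in>supp A.
          derivation_e (H m) w * F (shift (- m) w) + H m w * derivation_e F (shift (- m) w))"
          unfolding val[OF F] generator_act(3)[OF A F w True]
          by (rule derivation_act_sum[OF H t(2) inv_holD(1)[OF F] order_refl w])
      qed
    next
      case False
      then have w0: "w \<in> W0" using w by (simp add: W0_def)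
      show ?thesis
      proof (rule combination_in_space[OF t(2) comp_act_outside _ w_def s])
        fix F assume F: "F \<in> inv_hol"
        show "comp_act W v (evaluation s) A F = (\<Sum>m\<in>supp A.
          A m w * F (shift (- m) w) + 0 * derivation_e F (shift (- m) w))"
          unfolding val[OF F] generator_act(2)[OF A F w0] by simp
      qed
    qed
  qed
  have dv: "comp_act W v (derivative s) A \<in> dist_space" if s: "s \<in> shifts" for s
  proof -
    define w where "w = shift (- s) v"
    have w: "w \<in> W" using shift_point_W[OF s] by (simp add: w_def)
    have val: "comp_act W v (derivative s) A F = derivation_e (act W A F) w" if F: "F \<in> inv_hol" for F
      using pres F by (simp add: comp_act_apply derivative_def preserving_def w_def)
    show ?thesis
    proof (cases "z w = 0")
      case True
      show ?thesis
      proof (rule combination_in_space[OF t(2) comp_act_outside _ w_def s])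
        fix F assume F: "F \<in> inv_hol"
        show "comp_act W v (derivative s) A F = (\<Sum>m\<in>supp A.
          0 * F (shift (- m) w) + 0 * derivation_e F (shift (- m) w))"
          unfolding val[OF F] using derivation_on_hyperplane[OF generator_act(1)[OF A F] w True] by simp
      qed
    next
      case False
      then have w0: "w \<in> W0" using w by (simp add: W0_def)
      show ?thesis
      proof (rule combination_in_space[OF t(2) comp_act_outside _ w_def s])
        fix F assume F: "F \<in> inv_hol"
        have hol: "hol_on (\<lambda>x. \<Sum>m\<in>supp A. A m x * F (shift (- m) x)) W0"
          by (rule hol_on_act_sum[OF generator_hol[OF A] t(2) inv_holD(1)[OF F] open_W0(2)])
        have "derivation_e (act W A F) w = derivation_e (\<lambda>x. \<Sum>m\<in>supp A. A m x * F (shift (- m) x)) w"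
          by (rule derivation_cong[OF open_W0(1) w0 hol]) (rule generator_act(2)[OF A F, symmetric])
        also have "\<dots> = (\<Sum>m\<in>supp A.
          derivation_e (A m) w * F (shift (- m) w) + A m w * derivation_e F (shift (- m) w))"
          by (rule derivation_act_sum[OF generator_hol[OF A] t(2) inv_holD(1)[OF F] open_W0(2) w0])
        finally show "comp_act W v (derivative s) A F = (\<Sum>m\<in>supp A.
          derivation_e (A m) w * F (shift (- m) w) + A m w * derivation_e F (shift (- m) w))"
          unfolding val[OF F] .
      qed
    qed
  qed
  have "comp_act W v D A \<in> dist_space" if D: "D \<in> dist_space" for D
  proof (rule dist_space_induct[OF D _ ev dv])
    have "comp_act W v 0 A = 0" by (simp add: comp_act_def fun_eq_iff)
    then show "functional.subspace {D. comp_act W v D A \<in> dist_space}"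
      using dist_space_subspace
      by (auto simp: functional.subspace_def comp_act_left_add comp_act_left_scale)
  qed
  then show ?thesis using pres by (simp add: stable_def)
qed

lemma universal_ring_stable:
  assumes "A \<in> carrier (universal_ring p q v W)" shows "stable A"
proof -
  let ?X = "{A \<in> skew_invariants W v.
          \<exists>H. \<forall>m. hol_on (H m) W \<and> A m = reg W (\<lambda>x. H m x / z1 p q x)}"
  have "A \<in> generate_ring (skew_ring W) ?X" using assms by (simp add: universal_ring_def)
  then show ?thesis
  proof (induction rule: generate_ring.induct)
    case one
    show ?case
      unfolding skew_ring_simps stable_def
      using dist_space_linear by (simp add: preserving_one comp_act_const)
  next
    case (incl A)
    then obtain H where "generator A H" by (auto simp: generator_def)
    then show ?case by (rule generator_stable)
  next
    case (a_inv A)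
    then have "preserving A" by (simp add: stable_def)
    moreover from this have "a_inv (skew_ring W) A = - A"
      by (intro a_inv_tame) (simp add: preserving_def)
    moreover have "comp_act W v D (- A) \<in> dist_space" if D: "D \<in> dist_space" for D
    proof -
      have "comp_act W v D A \<in> dist_space" using a_inv D by (simp add: stable_def)
      then show ?thesis
        unfolding comp_act_minus[OF dist_space_linear[OF D] \<open>preserving A\<close>]
        by (rule functional.subspace_scale[OF dist_space_subspace])
    qed
    ultimately show ?case
      using preserving_minus unfolding stable_def by simp
  next
    case (eng_add A B)
    then show ?case
      using dist_space_linear comp_act_ring_add preserving_add functional.subspace_add[OF dist_space_subspace]
      by (simp add: stable_def)
  next
    case (eng_mult A B)
    then show ?case
      using comp_act_ring_mult preserving_mult by (simp add: stable_def)
  qed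
qed

end

section \<open>The enveloping algebra\<close>

lemma free_algebra_simps:
  "carrier free_algebra = UNIV" "mult free_algebra = (*)" "one free_algebra = 1"
  "zero free_algebra = 0" "add free_algebra = (+)"
  by (simp_all add: free_algebra_def)

lemma free_algebra_ring: "ring (free_algebra :: ('h word \<Rightarrow>\<^sub>0 complex) ring)"
proof (rule ringI)
  show "abelian_group (free_algebra :: ('h word \<Rightarrow>\<^sub>0 complex) ring)"
  proof (rule abelian_groupI)
    fix x :: "'h word \<Rightarrow>\<^sub>0 complex"
    show "\<exists>y\<in>carrier free_algebra. y \<oplus>\<^bsub>free_algebra\<^esub> x = \<zero>\<^bsub>free_algebra\<^esub>"
      by (intro bexI[of _ "- x"]) (simp_all add: free_algebra_simps)
  qed (simp_all add: free_algebra_simps algebra_simps)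
  show "monoid (free_algebra :: ('h word \<Rightarrow>\<^sub>0 complex) ring)"
    by (rule monoidI) (simp_all add: free_algebra_simps mult.assoc)
qed (simp_all add: free_algebra_simps algebra_simps)

text \<open>Needed since membership of a difference in the ideal is phrased with the subtraction of the ring record.\<close>

lemma free_algebra_minus:
  "(a :: 'h word \<Rightarrow>\<^sub>0 complex) \<ominus>\<^bsub>free_algebra\<^esub> b = a - b"
proof -
  interpret ring "free_algebra :: ('h word \<Rightarrow>\<^sub>0 complex) ring" by (rule free_algebra_ring)
  have "\<ominus>\<^bsub>free_algebra\<^esub> b = - b"
    by (rule minus_equality) (simp_all add: free_algebra_simps)
  then show ?thesis by (simp add: a_minus_def free_algebra_simps)
qed

context
  fixes smul :: "complex \<Rightarrow> 'h::ab_group_add \<Rightarrow> 'h" and bracket :: "'h \<Rightarrow> 'h \<Rightarrow> 'h"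
begin

abbreviation env_class :: "('h word \<Rightarrow>\<^sub>0 complex) \<Rightarrow> ('h word \<Rightarrow>\<^sub>0 complex) set" where
  "env_class a \<equiv> env_ideal smul bracket +>\<^bsub>free_algebra\<^esub> a"

lemma env_ideal_ideal: "ideal (env_ideal smul bracket) free_algebra"
  unfolding env_ideal_def
  by (rule ring.genideal_ideal[OF free_algebra_ring]) (simp add: free_algebra_simps)

lemma env_class_eqI:
  assumes "a - b \<in> env_relations smul bracket" shows "env_class a = env_class b"
proof -
  interpret ring "free_algebra :: ('h word \<Rightarrow>\<^sub>0 complex) ring" by (rule free_algebra_ring)
  have "env_relations smul bracket \<subseteq> env_ideal smul bracket"
    unfolding env_ideal_def by (rule genideal_self) (simp add: free_algebra_simps)
  then have "a \<ominus>\<^bsub>free_algebra\<^esub> b \<in> env_ideal smul bracket"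
    using assms by (auto simp: free_algebra_minus)
  then show ?thesis
    using quotient_eq_iff_same_a_r_cos[OF env_ideal_ideal, of a b] by (simp add: free_algebra_simps)
qed

lemma env_class_carrier: "env_class a \<in> carrier (env_algebra smul bracket)"
  unfolding env_algebra_def FactRing_def A_RCOSETS_def' by (auto simp: free_algebra_simps)

lemma env_class_add: "env_class a \<oplus>\<^bsub>env_algebra smul bracket\<^esub> env_class b = env_class (a + b)"
proof -
  interpret ideal "env_ideal smul bracket" "free_algebra :: ('h word \<Rightarrow>\<^sub>0 complex) ring"
    by (rule env_ideal_ideal)
  show ?thesis using a_rcos_sum[of a b] by (simp add: env_algebra_def FactRing_def free_algebra_simps)
qed

lemma env_class_mult: "env_class a \<otimes>\<^bsub>env_algebra smul bracket\<^esub> env_class b = env_class (a * b)"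
proof -
  interpret ideal "env_ideal smul bracket" "free_algebra :: ('h word \<Rightarrow>\<^sub>0 complex) ring"
    by (rule env_ideal_ideal)
  show ?thesis using rcoset_mult_add[of a b] by (simp add: env_algebra_def FactRing_def free_algebra_simps)
qed

lemma env_incl_add:
  "env_incl smul bracket (x + y) =
    env_incl smul bracket x \<oplus>\<^bsub>env_algebra smul bracket\<^esub> env_incl smul bracket y"
  unfolding env_incl_def env_class_add
  by (rule env_class_eqI) (auto simp: env_relations_def)

lemma env_incl_scale:
  "env_incl smul bracket (smul c x) =
    env_const smul bracket c \<otimes>\<^bsub>env_algebra smul bracket\<^esub> env_incl smul bracket x"
  unfolding env_incl_def env_const_def env_class_mult
  by (rule env_class_eqI) (auto simp: env_relations_def)

text \<open>The commutator relation is put as an equation between sums, so that a homomorphism can be applied to it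
  without computing the images of negatives.\<close>

lemma env_incl_bracket:
  "env_incl smul bracket x \<otimes>\<^bsub>env_algebra smul bracket\<^esub> env_incl smul bracket y =
    env_incl smul bracket y \<otimes>\<^bsub>env_algebra smul bracket\<^esub> env_incl smul bracket x
      \<oplus>\<^bsub>env_algebra smul bracket\<^esub> env_incl smul bracket (bracket x y)"
  unfolding env_incl_def env_class_mult env_class_add
proof (rule env_class_eqI)
  have "gen x * gen y - (gen y * gen x + gen (bracket x y)) = gen x * gen y - gen y * gen x - gen (bracket x y)"
    by (simp add: algebra_simps)
  then show "gen x * gen y - (gen y * gen x + gen (bracket x y)) \<in> env_relations smul bracket"
    unfolding env_relations_def by blast
qed

end

lemma singular_point_one_singular:
  assumes "one_singular p q x0" "v \<in> orbit x0" "z1 p q v = 0" "small_nbhd p q v W"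
  shows "singular_point p q v W"
proof
  show "row p = row q" "p \<noteq> q" using assms(1) by (auto simp: one_singular_def)
  show "z1 p q v = 0" by fact
  show "open W" using assms(4) by (simp add: small_nbhd_def)
  have "shift 0 v \<in> orbit v" unfolding orbit_def by (rule imageI) (rule shifts_closed(1))
  then show "v \<in> W" using assms(4) by (auto simp: small_nbhd_def)
  show "shift m x \<in> W" if "m \<in> shifts" "x \<in> W" for m x
    using assms(4) that by (auto simp: small_nbhd_def)
  show "permute (swap p q) x \<in> W" if "x \<in> W" for x
    using assms(4) that by (auto simp: small_nbhd_def)
  show "stabilizer v = {id, swap p q}" by (rule stabilizer_one_singular[OF assms(1-3)])
qed

theorem theorem3:
  fixes x0 v :: "'n::finite tableau"
    and p q :: "'n pos"
    and W :: "'n tableau set"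
    and smul :: "complex \<Rightarrow> 'h::ab_group_add \<Rightarrow> 'h"
    and bracket :: "'h \<Rightarrow> 'h \<Rightarrow> 'h"
    and \<Psi> :: "('h word \<Rightarrow>\<^sub>0 complex) set \<Rightarrow> 'n skew"
  assumes "CARD('n) \<ge> 2"
    and "one_singular p q x0"
    and "v \<in> orbit x0"
    and "z1 p q v = 0"
    and "small_nbhd p q v W"
    and "lie_algebra smul bracket"
    and "\<Psi> \<in> ring_hom (env_algebra smul bracket) (opposite (universal_ring p q v W))"
  shows "lie_ring_module bracket scale_functional (distribution_space p q v W)
      (\<lambda>X D. comp_act W v D (\<Psi> (env_incl smul bracket X))) \<and>
    ((\<forall>c. \<Psi> (env_const smul bracket c) = skew_const W c) \<longrightarrow>
      lie_module smul bracket scale_functional (distribution_space p q v W)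
        (\<lambda>X D. comp_act W v D (\<Psi> (env_incl smul bracket X))))"
proof -
  interpret singular_point p q v W
    by (rule singular_point_one_singular[OF assms(2-5)])
  let ?U = "env_algebra smul bracket"
  define incl where "incl = env_incl smul bracket"
  define rho where "rho X D = comp_act W v D (\<Psi> (incl X))" for X D
  have incl: "incl X \<in> carrier ?U" for X
    unfolding incl_def env_incl_def by (rule env_class_carrier)
  have const: "env_const smul bracket c \<in> carrier ?U" for c
    unfolding env_const_def by (rule env_class_carrier)
  have prod: "a \<otimes>\<^bsub>?U\<^esub> b \<in> carrier ?U" if "a \<in> range (env_class smul bracket)" "b \<in> range (env_class smul bracket)" for a b
    using that env_class_carrier by (auto simp: env_class_mult)
  have incl_range: "incl X \<in> range (env_class smul bracket)" for X by (simp add: incl_def env_incl_def)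
  have hom_carrier: "\<Psi> a \<in> carrier (universal_ring p q v W)" if "a \<in> carrier ?U" for a
    using ring_hom_closed[OF assms(7) that] by (simp add: opposite_def)
  have hom_mult: "\<Psi> (a \<otimes>\<^bsub>?U\<^esub> b) = monoid.mult (skew_ring W) (\<Psi> b) (\<Psi> a)"
    if "a \<in> carrier ?U" "b \<in> carrier ?U" for a b
    using ring_hom_mult[OF assms(7) that] by (simp add: opposite_def universal_ring_def)
  have hom_add: "\<Psi> (a \<oplus>\<^bsub>?U\<^esub> b) = add (skew_ring W) (\<Psi> a) (\<Psi> b)"
    if "a \<in> carrier ?U" "b \<in> carrier ?U" for a b
    using ring_hom_add[OF assms(7) that] by (simp add: opposite_def universal_ring_def)
  have st: "stable (\<Psi> a)" if "a \<in> carrier ?U" for a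
    by (rule universal_ring_stable[OF hom_carrier[OF that]])
  have pres: "preserving (\<Psi> a)" if "a \<in> carrier ?U" for a using st[OF that] by (simp add: stable_def)
  have act_sum: "comp_act W v D (\<Psi> (a \<oplus>\<^bsub>?U\<^esub> b)) = comp_act W v D (\<Psi> a) + comp_act W v D (\<Psi> b)"
    if "D \<in> dist_space" "a \<in> carrier ?U" "b \<in> carrier ?U" for a b D
    unfolding hom_add[OF that(2,3)]
    by (rule comp_act_ring_add[OF dist_space_linear[OF that(1)] pres[OF that(2)] pres[OF that(3)]])
  \<comment> \<open>The homomorphism goes to the opposite ring, so the right factor acts on functionals first and products of the
    enveloping algebra act as compositions.\<close>
  have act_prod: "comp_act W v D (\<Psi> (a \<otimes>\<^bsub>?U\<^esub> b)) = comp_act W v (comp_act W v D (\<Psi> b)) (\<Psi> a)"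
    if "a \<in> carrier ?U" "b \<in> carrier ?U" for a b D
    unfolding hom_mult[OF that] by (rule comp_act_ring_mult[OF pres[OF that(2)] pres[OF that(1)]])
  have closed: "rho X D \<in> dist_space" if "D \<in> dist_space" for X D
    using st[OF incl] that by (simp add: rho_def stable_def)
  have module: "lie_ring_module bracket scale_functional dist_space rho"
    unfolding lie_ring_module_def
  proof (intro conjI allI ballI)
    show "vector_space (scale_functional :: complex \<Rightarrow> 'n functional \<Rightarrow> 'n functional)"
      by (rule functional.vector_space_axioms)
    show "functional.subspace dist_space" by (rule dist_space_subspace)
    fix X Y c and D E :: "'n functional" assume D: "D \<in> dist_space"
    show "rho X D \<in> dist_space" by (rule closed[OF D])
    show "rho X (D + E) = rho X D + rho X E" by (simp add: rho_def comp_act_left_add)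
    show "rho X (scale_functional c D) = scale_functional c (rho X D)"
      by (simp add: rho_def comp_act_left_scale)
    show "rho (X + Y) D = rho X D + rho Y D"
      using act_sum[OF D incl incl, of X Y] env_incl_add[of smul bracket X Y] by (simp add: rho_def incl_def)
    have "rho X (rho Y D) = comp_act W v D (\<Psi> (incl X \<otimes>\<^bsub>?U\<^esub> incl Y))"
      by (simp add: rho_def act_prod[OF incl incl])
    also have "\<dots> = comp_act W v D (\<Psi> (incl Y \<otimes>\<^bsub>?U\<^esub> incl X)) + rho (bracket X Y) D"
      unfolding incl_def env_incl_bracket[of smul bracket X Y]
      using act_sum[OF D prod[OF incl_range incl_range] incl] by (simp add: incl_def rho_def)
    also have "\<dots> = rho Y (rho X D) + rho (bracket X Y) D"
      by (simp add: rho_def act_prod[OF incl incl])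
    finally show "rho (bracket X Y) D = rho X (rho Y D) - rho Y (rho X D)" by simp
  qed
  moreover have "lie_module smul bracket scale_functional dist_space rho"
    if c: "\<forall>c. \<Psi> (env_const smul bracket c) = skew_const W c"
    unfolding lie_module_def
  proof (intro conjI module allI ballI)
    fix a X D assume D: "D \<in> dist_space"
    have "rho (smul a X) D = comp_act W v (rho X D) (\<Psi> (env_const smul bracket a))"
      using act_prod[OF const incl, of D a X] env_incl_scale[of smul bracket a X] by (simp add: rho_def incl_def)
    also have "\<dots> = scale_functional a (rho X D)"
      using c comp_act_const[OF dist_space_linear[OF closed[OF D]]] by simp
    finally show "rho (smul a X) D = scale_functional a (rho X D)" .
  qed
  ultimately show ?thesis unfolding rho_def incl_def by blast
qed

end
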